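(* Let $(M,\Pi)\stackrel{\phi}{\to}(B,\pi)$ be an NCI system of rank $r$ with compact fibers, with action lattice sheaf $\mathcal L_B$. The following properties are equivalent: (i) There exists a set of global action variables. (ii) The action lattice sheaf $\mathcal L_B$ admits a (global) trivialization and every global section $\ell$ of $\mathcal L_B$ satisfies $\operatorname{Obs}(\ell)=0$.
   Context: All manifolds and objects are smooth and real. For a Poisson manifold $(M,\Pi)$ write $\{f,g\}=\Pi(df,dg)$; the Hamiltonian vector field $X_h$ is given by $X_h(g)=\{g,h\}$, and $\Pi^\sharp:T^*M\to TM$ is the induced bundle map, with $\Pi^\sharp(dh)=-X_h$. A (local) first integral of a foliation is a (locally defined) function constant on its leaves. An abstract NCI system of rank $r$ on $(M,\Pi)$ is an $r$-dimensional foliation $\mathfrak F$ of $M$ whose tangent bundle is spanned by Hamiltonian vector fields of local first integrals: each $m\in M$ has a neighborhood on which there are first integrals $f_1,\dots,f_r$ of $\mathfrak F$ such that $X_{f_1},\dots,X_{f_r}$ span $T\mathfrak F$ at every point. An NCI system $(M,\Pi)\stackrel{\phi}{\to}(B,\pi)$ of rank $r$ is such an abstract NCI system whose leaf space $B$ is a smooth Hausdorff manifold; $\phi:M\to B$ is the quotient map, a surjective submersion whose fibers are the (connected) leaves of $\mathfrak F$, and $\pi$ is the unique Poisson structure on $B$ making $\phi$ a Poisson map. It has compact fibers if all fibers of $\phi$ are compact. Action bundle and lattice. The action sheaf is $\mathcal E_B=\operatorname{Ker}\pi^\sharp/\operatorname{Ker}(\Pi^\sharp\circ\phi^* )$ (quotient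 of sheaves of 1-forms $\omega$ on open subsets of $B$ with $\pi^\sharp\omega=0$, respectively $\Pi^\sharp(\phi^*\omega)=0$); it is the sheaf of sections of a rank $r$ vector bundle $E\to B$ with fiber $E_b=\operatorname{Ker}(\pi_b^\sharp)/\{\xi\in T_b^*B\mid \Pi_m^\sharp(\phi^*\xi)=0\}$ ($m\in\phi^{-1}(b)$ arbitrary). The class of $\omega$ is denoted $[\omega]$. For $\alpha\in E_b$ the action vector field on $\phi^{-1}(b)$ is $X_\alpha(m)=\Pi_m^\sharp(\phi^*\alpha)$. When the fibers are compact, $L_b:=\{\alpha\in E_b\mid \text{the time 1 flow of }X_\alpha\text{ is the identity of }\phi^{-1}(b)\}$ is a lattice in $E_b$; these form a bundle $L\to B$ with fiber $\mathbb Z^r$, and $\mathcal L_B$ denotes its sheaf of local sections (a subsheaf of $\mathcal E_B$). A trivialization of $\mathcal L_B$ on an open set $V$ is an isomorphism with the constant sheaf $\mathbb Z^r$ on $V$, i.e. an $r$-tuple of sections of $\mathcal L_B$ over $V$ whose values at each $b\in V$ form a $\mathbb Z$-basis of $L_b$. A set of global action variables is an $r$-tuple $(p_1,\dots,p_r)$ of functions on $B$ (which are Casimir functions of $\pi$) such that $[dp_1],\dots,[dp_r]$ define a trivialization of $\mathcal L_B$ on $B$. Obstruction map. $\mathcal{C}as_B$ is the sheaf of Casimir functions of $\pi$; $\mathcal{C}as_B^M$ is the sheaf of functions $F$ on open $V\subset B$ such that $F\circ\phi$ is a Casimir of $\Pi|_{\phi^{-1}(V)}$; $\mathcal E_B^0$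 is the subsheaf of $\mathcal E_B$ of locally holonomic sections, i.e. those locally of the form $[dg]$ with $g$ a local Casimir of $\pi$. There is a short exact sequence of sheaves of real vector spaces $0\to\mathcal{C}as_B^M\to\mathcal{C}as_B\xrightarrow{[d\,\cdot]}\mathcal E_B^0\to0$, and $\operatorname{Obs}:H^0(B,\mathcal E_B^0)\to H^1(B,\mathcal{C}as_B^M)$ is the connecting homomorphism of its long exact cohomology sequence. The sheaf $\mathcal L_B$ is a subsheaf of $\mathcal E^0_B$, so $\operatorname{Obs}(\ell)$ is defined for every global section $\ell$ of $\mathcal L_B$. *)

theory Defs
  imports "HOL-Analysis.Analysis"
begin

section \<open>Smooth functions on open subsets of Euclidean space\<close>

text \<open>The model space \<open>\<real>\<^sup>n\<close> is the library topology \<^const>\<open>Euclidean_space\<close>, whose points are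
  the sequences \<open>x :: nat \<Rightarrow> real\<close> with \<open>x i = 0\<close> for \<open>i \<ge> n\<close>. The dimension \<open>n = 0\<close> is allowed.\<close>

definition partial_deriv :: "nat \<Rightarrow> ((nat \<Rightarrow> real) \<Rightarrow> real) \<Rightarrow> (nat \<Rightarrow> real) \<Rightarrow> real" where
  "partial_deriv i f z = deriv (\<lambda>t. f (z(i := t))) (z i)"

fun Ck_on :: "nat \<Rightarrow> nat \<Rightarrow> (nat \<Rightarrow> real) set \<Rightarrow> ((nat \<Rightarrow> real) \<Rightarrow> real) \<Rightarrow> bool" where
  "Ck_on 0 n W f \<longleftrightarrow> continuous_map (subtopology (Euclidean_space n) W) euclideanreal f"
| "Ck_on (Suc k) n W f \<longleftrightarrow>
     continuous_map (subtopology (Euclidean_space n) W) euclideanreal f \<and>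
     (\<forall>i<n. (\<forall>z\<in>W. (\<lambda>t. f (z(i := t))) field_differentiable at (z i)) \<and>
            Ck_on k n W (partial_deriv i f))"

definition Cinf_on :: "nat \<Rightarrow> (nat \<Rightarrow> real) set \<Rightarrow> ((nat \<Rightarrow> real) \<Rightarrow> real) \<Rightarrow> bool" where
  "Cinf_on n W f \<longleftrightarrow> (\<forall>k. Ck_on k n W f)"


section \<open>Smooth manifolds\<close>

type_synonym 'a chart = "'a set \<times> ('a \<Rightarrow> nat \<Rightarrow> real)"

record 'a manifold =
  mtop :: "'a topology"
  mdim :: nat
  matlas :: "'a chart set"

definition is_chart :: "'a topology \<Rightarrow> nat \<Rightarrow> 'a chart \<Rightarrow> bool" where
  "is_chart X n = (\<lambda>(U, x). openin X U \<and> openin (Euclidean_space n) (x ` U) \<and>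
     homeomorphic_map (subtopology X U) (subtopology (Euclidean_space n) (x ` U)) x)"

definition smooth_transition :: "nat \<Rightarrow> 'a chart \<Rightarrow> 'a chart \<Rightarrow> bool" where
  "smooth_transition n = (\<lambda>(U, x) (V, y).
     \<forall>j<n. Cinf_on n (x ` (U \<inter> V)) (\<lambda>z. y (inv_into U x z) j))"

definition smooth_manifold :: "('a, 'z) manifold_scheme \<Rightarrow> bool" where
  "smooth_manifold M \<longleftrightarrow>
     Hausdorff_space (mtop M) \<and> second_countable (mtop M) \<and>
     (\<forall>c\<in>matlas M. is_chart (mtop M) (mdim M) c) \<and>
     \<Union> (fst ` matlas M) = topspace (mtop M) \<and>
     (\<forall>c\<in>matlas M. \<forall>d\<in>matlas M. smooth_transition (mdim M) c d)"

text \<open>The charts of the maximal atlas.\<close>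

definition smooth_chart :: "('a, 'z) manifold_scheme \<Rightarrow> 'a chart \<Rightarrow> bool" where
  "smooth_chart M c \<longleftrightarrow> is_chart (mtop M) (mdim M) c \<and>
     (\<forall>d\<in>matlas M. smooth_transition (mdim M) c d \<and> smooth_transition (mdim M) d c)"

text \<open>A function on an open set \<open>V\<close> is represented by a total function whose values
  outside \<open>V\<close> are irrelevant.\<close>

definition smooth_on :: "('a, 'z) manifold_scheme \<Rightarrow> 'a set \<Rightarrow> ('a \<Rightarrow> real) \<Rightarrow> bool" where
  "smooth_on M V f \<longleftrightarrow> openin (mtop M) V \<and>
     (\<forall>(U, x)\<in>matlas M. Cinf_on (mdim M) (x ` (U \<inter> V)) (\<lambda>z. f (inv_into U x z)))"

definition smooth_at :: "('a, 'z) manifold_scheme \<Rightarrow> 'a \<Rightarrow> ('a \<Rightarrow> real) \<Rightarrow> bool" where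
  "smooth_at M m f \<longleftrightarrow> (\<exists>V. m \<in> V \<and> smooth_on M V f)"

definition smooth_map ::
  "('a, 'z) manifold_scheme \<Rightarrow> ('b, 'y) manifold_scheme \<Rightarrow> ('a \<Rightarrow> 'b) \<Rightarrow> bool" where
  "smooth_map M B \<phi> \<longleftrightarrow> continuous_map (mtop M) (mtop B) \<phi> \<and>
     (\<forall>V f. smooth_on B V f \<longrightarrow> smooth_on M {m \<in> topspace (mtop M). \<phi> m \<in> V} (f \<circ> \<phi>))"


section \<open>Tangent vectors, covectors and one-forms\<close>

text \<open>Tangent vectors at \<open>m\<close> are the derivations of the algebra of germs at \<open>m\<close> of smooth
  functions, extended by \<open>0\<close> to the functions that are not smooth near \<open>m\<close>. Covectors are the
  linear forms on the tangent space, extended by \<open>0\<close> outside of it. With these conventions equality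
  of tangent vectors or covectors is equality in HOL.\<close>

type_synonym 'a tvec = "('a \<Rightarrow> real) \<Rightarrow> real"
type_synonym 'a covec = "'a tvec \<Rightarrow> real"

definition tangent_space :: "('a, 'z) manifold_scheme \<Rightarrow> 'a \<Rightarrow> 'a tvec set" where
  "tangent_space M m = {v.
     (\<forall>f. \<not> smooth_at M m f \<longrightarrow> v f = 0) \<and>
     (\<forall>V f g. m \<in> V \<and> smooth_on M V f \<and> (\<forall>p\<in>V. f p = g p) \<longrightarrow> v f = v g) \<and>
     (\<forall>f g. smooth_at M m f \<and> smooth_at M m g \<longrightarrow> v (\<lambda>p. f p + g p) = v f + v g) \<and>
     (\<forall>c f. smooth_at M m f \<longrightarrow> v (\<lambda>p. c * f p) = c * v f) \<and>
     (\<forall>f g. smooth_at M m f \<and> smooth_at M m g \<longrightarrow>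
        v (\<lambda>p. f p * g p) = f m * v g + g m * v f)}"

definition cotangent_space :: "('a, 'z) manifold_scheme \<Rightarrow> 'a \<Rightarrow> 'a covec set" where
  "cotangent_space M m = {\<xi>.
     (\<forall>v. v \<notin> tangent_space M m \<longrightarrow> \<xi> v = 0) \<and>
     (\<forall>v\<in>tangent_space M m. \<forall>w\<in>tangent_space M m. \<xi> (\<lambda>f. v f + w f) = \<xi> v + \<xi> w) \<and>
     (\<forall>c. \<forall>v\<in>tangent_space M m. \<xi> (\<lambda>f. c * v f) = c * \<xi> v)}"

definition differential :: "('a, 'z) manifold_scheme \<Rightarrow> ('a \<Rightarrow> real) \<Rightarrow> 'a \<Rightarrow> 'a covec" where
  "differential M f m = (\<lambda>v. if v \<in> tangent_space M m then v f else 0)"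

definition pushforward ::
  "('b, 'y) manifold_scheme \<Rightarrow> ('a \<Rightarrow> 'b) \<Rightarrow> 'a \<Rightarrow> 'a tvec \<Rightarrow> 'b tvec" where
  "pushforward B \<phi> m v = (\<lambda>f. if smooth_at B (\<phi> m) f then v (f \<circ> \<phi>) else 0)"

definition pullback ::
  "('a, 'z) manifold_scheme \<Rightarrow> ('b, 'y) manifold_scheme \<Rightarrow> ('a \<Rightarrow> 'b) \<Rightarrow> 'a \<Rightarrow> 'b covec \<Rightarrow> 'a covec" where
  "pullback M B \<phi> m \<xi> = (\<lambda>v. if v \<in> tangent_space M m then \<xi> (pushforward B \<phi> m v) else 0)"

definition one_form :: "('a, 'z) manifold_scheme \<Rightarrow> 'a set \<Rightarrow> ('a \<Rightarrow> 'a covec) \<Rightarrow> bool" where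
  "one_form M V \<omega> \<longleftrightarrow> openin (mtop M) V \<and>
     (\<forall>(U, x)\<in>matlas M. \<exists>a. (\<forall>j<mdim M. smooth_on M (U \<inter> V) (a j)) \<and>
        (\<forall>m\<in>U \<inter> V. \<omega> m = (\<lambda>v. \<Sum>j<mdim M. a j m * differential M (\<lambda>p. x p j) m v)))"

definition submersion ::
  "('a, 'z) manifold_scheme \<Rightarrow> ('b, 'y) manifold_scheme \<Rightarrow> ('a \<Rightarrow> 'b) \<Rightarrow> bool" where
  "submersion M B \<phi> \<longleftrightarrow> smooth_map M B \<phi> \<and>
     (\<forall>m\<in>topspace (mtop M).
        pushforward B \<phi> m ` tangent_space M m = tangent_space B (\<phi> m))"


section \<open>Poisson manifolds\<close>

record 'a poisson = "'a manifold" +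
  bivector :: "'a \<Rightarrow> 'a covec \<Rightarrow> 'a covec \<Rightarrow> real"

definition bracket ::
  "('a, 'z) poisson_scheme \<Rightarrow> ('a \<Rightarrow> real) \<Rightarrow> ('a \<Rightarrow> real) \<Rightarrow> 'a \<Rightarrow> real" where
  "bracket M f g m = bivector M m (differential M f m) (differential M g m)"

definition poisson_manifold :: "('a, 'z) poisson_scheme \<Rightarrow> bool" where
  "poisson_manifold M \<longleftrightarrow> smooth_manifold M \<and>
     (\<forall>m\<in>topspace (mtop M).
        \<forall>\<xi>\<in>cotangent_space M m. \<forall>\<eta>\<in>cotangent_space M m.
          bivector M m \<xi> \<eta> = - bivector M m \<eta> \<xi> \<and>
          (\<forall>c. bivector M m (\<lambda>v. c * \<xi> v) \<eta> = c * bivector M m \<xi> \<eta>) \<and>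
          (\<forall>\<zeta>\<in>cotangent_space M m.
             bivector M m (\<lambda>v. \<xi> v + \<eta> v) \<zeta> = bivector M m \<xi> \<zeta> + bivector M m \<eta> \<zeta>)) \<and>
     (\<forall>V f g. smooth_on M V f \<and> smooth_on M V g \<longrightarrow> smooth_on M V (bracket M f g)) \<and>
     (\<forall>V f g h. smooth_on M V f \<and> smooth_on M V g \<and> smooth_on M V h \<longrightarrow>
        (\<forall>m\<in>V. bracket M f (bracket M g h) m + bracket M g (bracket M h f) m +
                bracket M h (bracket M f g) m = 0))"

text \<open>\<open>X\<^sub>h(g) = {g, h}\<close> and \<open>\<Pi>\<^sup>\<sharp>(\<xi>)(g) = \<Pi>(\<xi>, dg)\<close>, so that \<open>\<Pi>\<^sup>\<sharp>(dh) = - X\<^sub>h\<close>.\<close>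

definition hamiltonian :: "('a, 'z) poisson_scheme \<Rightarrow> ('a \<Rightarrow> real) \<Rightarrow> 'a \<Rightarrow> 'a tvec" where
  "hamiltonian M h m = (\<lambda>g. if smooth_at M m g then bracket M g h m else 0)"

definition sharp :: "('a, 'z) poisson_scheme \<Rightarrow> 'a \<Rightarrow> 'a covec \<Rightarrow> 'a tvec" where
  "sharp M m \<xi> = (\<lambda>g. if smooth_at M m g then bivector M m \<xi> (differential M g m) else 0)"

definition casimir :: "('a, 'z) poisson_scheme \<Rightarrow> 'a set \<Rightarrow> ('a \<Rightarrow> real) \<Rightarrow> bool" where
  "casimir M V f \<longleftrightarrow> smooth_on M V f \<and> (\<forall>m\<in>V. hamiltonian M f m = (\<lambda>_. 0))"

definition poisson_map ::
  "('a, 'z) poisson_scheme \<Rightarrow> ('b, 'y) poisson_scheme \<Rightarrow> ('a \<Rightarrow> 'b) \<Rightarrow> bool" where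
  "poisson_map M B \<phi> \<longleftrightarrow> smooth_map M B \<phi> \<and>
     (\<forall>V f g. smooth_on B V f \<and> smooth_on B V g \<longrightarrow>
        (\<forall>m\<in>topspace (mtop M). \<phi> m \<in> V \<longrightarrow>
           bracket M (f \<circ> \<phi>) (g \<circ> \<phi>) m = bracket B f g (\<phi> m)))"


section \<open>Foliations\<close>

text \<open>A plaque of a chart with values in an open cube is a slice on which the last \<open>n - r\<close>
  coordinates are constant. A chart is flat for a partition \<open>F\<close> if every member of \<open>F\<close> meets its
  domain in a countable (possibly empty) union of plaques.\<close>

definition same_plaque :: "('a, 'z) manifold_scheme \<Rightarrow> nat \<Rightarrow> 'a chart \<Rightarrow> 'a \<Rightarrow> 'a \<Rightarrow> bool" where
  "same_plaque M r = (\<lambda>(U, x) a b. a \<in> U \<and> b \<in> U \<and> (\<forall>j\<in>{r..<mdim M}. x a j = x b j))"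

definition flat_chart :: "('a, 'z) manifold_scheme \<Rightarrow> nat \<Rightarrow> 'a set set \<Rightarrow> 'a chart \<Rightarrow> bool" where
  "flat_chart M r F = (\<lambda>(U, x). smooth_chart M (U, x) \<and>
     x ` U = {z \<in> topspace (Euclidean_space (mdim M)). \<forall>i<mdim M. -1 < z i \<and> z i < 1} \<and>
     (\<forall>L\<in>F. \<exists>C :: (nat \<Rightarrow> real) set. countable C \<and>
        L \<inter> U = {m \<in> U. \<exists>c\<in>C. \<forall>j\<in>{r..<mdim M}. x m j = c j}))"

text \<open>Two points are related if they lie on the same leaf of the foliation restricted to the open
  set \<open>V\<close>, that is, if a finite chain of plaques contained in \<open>V\<close> joins them.\<close>

definition leaf_rel :: "('a, 'z) manifold_scheme \<Rightarrow> nat \<Rightarrow> 'a set set \<Rightarrow> 'a set \<Rightarrow> ('a \<times> 'a) set" where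
  "leaf_rel M r F V =
     {(a, b). \<exists>c. flat_chart M r F c \<and> fst c \<subseteq> V \<and> same_plaque M r c a b}\<^sup>*"

text \<open>The last condition states that the leaves are connected for the leaf topology.\<close>

definition foliation :: "('a, 'z) manifold_scheme \<Rightarrow> nat \<Rightarrow> 'a set set \<Rightarrow> bool" where
  "foliation M r F \<longleftrightarrow> r \<le> mdim M \<and> partition_on (topspace (mtop M)) F \<and>
     (\<forall>m\<in>topspace (mtop M). \<exists>c. flat_chart M r F c \<and> m \<in> fst c) \<and>
     (\<forall>L\<in>F. \<forall>a\<in>L. \<forall>b\<in>L. (a, b) \<in> leaf_rel M r F (topspace (mtop M)))"

definition foliation_tangent ::
  "('a, 'z) manifold_scheme \<Rightarrow> nat \<Rightarrow> 'a set set \<Rightarrow> 'a \<Rightarrow> 'a tvec set" where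
  "foliation_tangent M r F m = {v \<in> tangent_space M m.
     \<forall>U x. flat_chart M r F (U, x) \<and> m \<in> U \<longrightarrow> (\<forall>j\<in>{r..<mdim M}. v (\<lambda>p. x p j) = 0)}"

definition first_integral ::
  "('a, 'z) manifold_scheme \<Rightarrow> nat \<Rightarrow> 'a set set \<Rightarrow> 'a set \<Rightarrow> ('a \<Rightarrow> real) \<Rightarrow> bool" where
  "first_integral M r F V f \<longleftrightarrow> smooth_on M V f \<and>
     (\<forall>a\<in>V. \<forall>b\<in>V. (a, b) \<in> leaf_rel M r F V \<longrightarrow> f a = f b)"


section \<open>NCI systems\<close>

definition abstract_nci :: "('a, 'z) poisson_scheme \<Rightarrow> nat \<Rightarrow> 'a set set \<Rightarrow> bool" where
  "abstract_nci M r F \<longleftrightarrow> poisson_manifold M \<and> foliation M r F \<and>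
     (\<forall>m\<in>topspace (mtop M). \<exists>V f. openin (mtop M) V \<and> m \<in> V \<and>
        (\<forall>i<r. first_integral M r F V (f i)) \<and>
        (\<forall>u\<in>V. foliation_tangent M r F u =
           {\<lambda>g. \<Sum>i<r. c i * hamiltonian M (f i) u g | c :: nat \<Rightarrow> real. True}))"

record ('a, 'b) nci =
  total :: "'a poisson"
  base :: "'b poisson"
  proj :: "'a \<Rightarrow> 'b"
  nci_rank :: nat

abbreviation base_space :: "('a, 'b) nci \<Rightarrow> 'b set" where
  "base_space N \<equiv> topspace (mtop (base N))"

abbreviation base_open :: "('a, 'b) nci \<Rightarrow> 'b set \<Rightarrow> bool" where
  "base_open N \<equiv> openin (mtop (base N))"

definition preimage :: "('a, 'b) nci \<Rightarrow> 'b set \<Rightarrow> 'a set" where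
  "preimage N V = {m \<in> topspace (mtop (total N)). proj N m \<in> V}"

abbreviation fibre :: "('a, 'b) nci \<Rightarrow> 'b \<Rightarrow> 'a set" where
  "fibre N b \<equiv> preimage N {b}"

definition nci_system :: "('a, 'b) nci \<Rightarrow> bool" where
  "nci_system N \<longleftrightarrow>
     (\<exists>F. abstract_nci (total N) (nci_rank N) F \<and> F = fibre N ` base_space N) \<and>
     poisson_manifold (base N) \<and>
     quotient_map (mtop (total N)) (mtop (base N)) (proj N) \<and>
     submersion (total N) (base N) (proj N) \<and>
     poisson_map (total N) (base N) (proj N)"

definition compact_fibres :: "('a, 'b) nci \<Rightarrow> bool" where
  "compact_fibres N \<longleftrightarrow> (\<forall>b\<in>base_space N. compactin (mtop (total N)) (fibre N b))"


section \<open>The action bundle and the action lattice\<close>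

abbreviation pull :: "('a, 'b) nci \<Rightarrow> 'a \<Rightarrow> 'b covec \<Rightarrow> 'a covec" where
  "pull N m \<equiv> pullback (total N) (base N) (proj N) m"

definition ker_base :: "('a, 'b) nci \<Rightarrow> 'b \<Rightarrow> 'b covec set" where
  "ker_base N b = {\<xi> \<in> cotangent_space (base N) b. sharp (base N) b \<xi> = (\<lambda>_. 0)}"

text \<open>Whether \<open>\<Pi>\<^sup>\<sharp>\<^sub>m(\<phi>\<^sup>*\<xi>) = 0\<close> does not depend on the point \<open>m\<close> of the fibre.\<close>

definition ker_total :: "('a, 'b) nci \<Rightarrow> 'b \<Rightarrow> 'b covec set" where
  "ker_total N b = {\<xi> \<in> cotangent_space (base N) b.
     \<forall>m\<in>fibre N b. sharp (total N) m (pull N m \<xi>) = (\<lambda>_. 0)}"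

text \<open>The elements of the fibre \<open>E\<^sub>b\<close> of the action bundle are cosets; \<open>act_class N b \<xi>\<close> is \<open>[\<xi>]\<close>.\<close>

definition act_class :: "('a, 'b) nci \<Rightarrow> 'b \<Rightarrow> 'b covec \<Rightarrow> 'b covec set" where
  "act_class N b \<xi> = {\<eta> \<in> ker_base N b. (\<lambda>v. \<eta> v - \<xi> v) \<in> ker_total N b}"

definition act_fibre :: "('a, 'b) nci \<Rightarrow> 'b \<Rightarrow> 'b covec set set" where
  "act_fibre N b = act_class N b ` ker_base N b"

text \<open>The linear combination \<open>\<Sum>i<k. c i \<cdot> \<alpha> i\<close> in the quotient space \<open>E\<^sub>b\<close>: the class of the
  corresponding linear combination of representatives. All choices of representatives give the
  same class, so the union below is the union of a single set.\<close>

definition act_comb ::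
  "('a, 'b) nci \<Rightarrow> 'b \<Rightarrow> nat \<Rightarrow> (nat \<Rightarrow> real) \<Rightarrow> (nat \<Rightarrow> 'b covec set) \<Rightarrow> 'b covec set" where
  "act_comb N b k c \<alpha> =
     \<Union> {act_class N b (\<lambda>v. \<Sum>i<k. c i * \<xi> i v) | \<xi>. \<forall>i<k. \<xi> i \<in> \<alpha> i}"

definition action_field :: "('a, 'b) nci \<Rightarrow> 'b covec set \<Rightarrow> 'a \<Rightarrow> 'a tvec" where
  "action_field N \<alpha> m = sharp (total N) m (pull N m (SOME \<xi>. \<xi> \<in> \<alpha>))"

text \<open>\<open>\<Phi>\<close> is the complete flow on \<open>S\<close> of the vector field \<open>X\<close> tangent to \<open>S\<close>.\<close>

definition is_flow ::
  "('a, 'z) manifold_scheme \<Rightarrow> 'a set \<Rightarrow> ('a \<Rightarrow> 'a tvec) \<Rightarrow> (real \<Rightarrow> 'a \<Rightarrow> 'a) \<Rightarrow> bool" where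
  "is_flow M S X \<Phi> \<longleftrightarrow> (\<forall>m\<in>S. \<Phi> 0 m = m \<and>
     continuous_map euclideanreal (mtop M) (\<lambda>t. \<Phi> t m) \<and>
     (\<forall>t. \<Phi> t m \<in> S \<and>
        (\<forall>f. smooth_at M (\<Phi> t m) f \<longrightarrow>
           ((\<lambda>s. f (\<Phi> s m)) has_real_derivative X (\<Phi> t m) f) (at t))))"

definition lattice_fibre :: "('a, 'b) nci \<Rightarrow> 'b \<Rightarrow> 'b covec set set" where
  "lattice_fibre N b = {\<alpha> \<in> act_fibre N b.
     \<exists>\<Phi>. is_flow (total N) (fibre N b) (action_field N \<alpha>) \<Phi> \<and> (\<forall>m\<in>fibre N b. \<Phi> 1 m = m)}"

text \<open>Sections over \<open>V\<close> of the quotient sheaf \<open>Ker \<pi>\<^sup>\<sharp> / Ker (\<Pi>\<^sup>\<sharp> \<circ> \<phi>\<^sup>*)\<close>, viewed as maps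
  \<open>b \<mapsto> s b \<in> E\<^sub>b\<close>; values outside \<open>V\<close> are irrelevant.\<close>

definition action_section :: "('a, 'b) nci \<Rightarrow> 'b set \<Rightarrow> ('b \<Rightarrow> 'b covec set) \<Rightarrow> bool" where
  "action_section N V s \<longleftrightarrow> base_open N V \<and>
     (\<forall>b\<in>V. \<exists>W \<omega>. base_open N W \<and> b \<in> W \<and> W \<subseteq> V \<and> one_form (base N) W \<omega> \<and>
        (\<forall>c\<in>W. \<omega> c \<in> ker_base N c \<and> s c = act_class N c (\<omega> c)))"

definition lattice_section :: "('a, 'b) nci \<Rightarrow> 'b set \<Rightarrow> ('b \<Rightarrow> 'b covec set) \<Rightarrow> bool" where
  "lattice_section N V s \<longleftrightarrow> action_section N V s \<and> (\<forall>b\<in>V. s b \<in> lattice_fibre N b)"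

text \<open>A \<open>\<int>\<close>-basis of \<open>L\<^sub>b\<close>: every element of \<open>L\<^sub>b\<close> is a unique integer combination of the
  \<open>\<alpha> i\<close>, \<open>i < k\<close>, and all these combinations lie in \<open>L\<^sub>b\<close>.\<close>

definition lattice_basis :: "('a, 'b) nci \<Rightarrow> 'b \<Rightarrow> nat \<Rightarrow> (nat \<Rightarrow> 'b covec set) \<Rightarrow> bool" where
  "lattice_basis N b k \<alpha> \<longleftrightarrow>
     bij_betw (\<lambda>n. act_comb N b k (\<lambda>i. of_int (n i)) \<alpha>)
       ({..<k} \<rightarrow>\<^sub>E (UNIV :: int set)) (lattice_fibre N b)"

definition lattice_trivialization ::
  "('a, 'b) nci \<Rightarrow> 'b set \<Rightarrow> (nat \<Rightarrow> 'b \<Rightarrow> 'b covec set) \<Rightarrow> bool" where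
  "lattice_trivialization N V l \<longleftrightarrow>
     (\<forall>i<nci_rank N. lattice_section N V (l i)) \<and>
     (\<forall>b\<in>V. lattice_basis N b (nci_rank N) (\<lambda>i. l i b))"

text \<open>The section \<open>[dg]\<close>.\<close>

definition d_class :: "('a, 'b) nci \<Rightarrow> ('b \<Rightarrow> real) \<Rightarrow> 'b \<Rightarrow> 'b covec set" where
  "d_class N g b = act_class N b (differential (base N) g b)"

definition global_action_variables :: "('a, 'b) nci \<Rightarrow> (nat \<Rightarrow> 'b \<Rightarrow> real) \<Rightarrow> bool" where
  "global_action_variables N p \<longleftrightarrow>
     (\<forall>i<nci_rank N. casimir (base N) (base_space N) (p i)) \<and>
     lattice_trivialization N (base_space N) (\<lambda>i. d_class N (p i))"


section \<open>First cohomology and the obstruction map\<close>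

text \<open>\<open>H\<^sup>1(X, S)\<close> for a sheaf \<open>S\<close> of real-valued functions, as first Cech cohomology, which for
  every topological space and every sheaf of abelian groups is the first sheaf cohomology. It is the
  direct limit over all open covers, refined by inclusion, of the groups of 1-cocycles modulo
  coboundaries. A cover is a set of open sets indexed by itself, and an element of the limit
  is an equivalence class of pairs (cover, cocycle). A family of functions over a cover is only
  constrained on the relevant (intersections of) members of that cover.\<close>

type_synonym 'b fun_sheaf = "'b set \<Rightarrow> ('b \<Rightarrow> real) set"
type_synonym 'b cochain1 = "'b set set \<times> ('b set \<Rightarrow> 'b set \<Rightarrow> 'b \<Rightarrow> real)"

definition open_cover :: "'b topology \<Rightarrow> 'b set set \<Rightarrow> bool" where
  "open_cover X \<U> \<longleftrightarrow> (\<forall>U\<in>\<U>. openin X U) \<and> \<Union> \<U> = topspace X"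

definition cocycles1 :: "'b topology \<Rightarrow> 'b fun_sheaf \<Rightarrow> 'b cochain1 set" where
  "cocycles1 X S = {(\<U>, c). open_cover X \<U> \<and>
     (\<forall>U\<in>\<U>. \<forall>V\<in>\<U>. c U V \<in> S (U \<inter> V)) \<and>
     (\<forall>U\<in>\<U>. \<forall>V\<in>\<U>. \<forall>W\<in>\<U>. \<forall>x\<in>U \<inter> V \<inter> W. c V W x - c U W x + c U V x = 0)}"

definition cohomologous ::
  "'b topology \<Rightarrow> 'b fun_sheaf \<Rightarrow> ('b cochain1 \<times> 'b cochain1) set" where
  "cohomologous X S = {((\<U>, c), (\<V>, d)).
     (\<U>, c) \<in> cocycles1 X S \<and> (\<V>, d) \<in> cocycles1 X S \<and>
     (\<exists>\<W> \<rho> \<sigma> h. open_cover X \<W> \<and>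
        (\<forall>W\<in>\<W>. \<rho> W \<in> \<U> \<and> W \<subseteq> \<rho> W \<and> \<sigma> W \<in> \<V> \<and> W \<subseteq> \<sigma> W \<and> h W \<in> S W) \<and>
        (\<forall>W\<in>\<W>. \<forall>W'\<in>\<W>. \<forall>x\<in>W \<inter> W'.
           c (\<rho> W) (\<rho> W') x - d (\<sigma> W) (\<sigma> W') x = h W' x - h W x))}"

definition H1 :: "'b topology \<Rightarrow> 'b fun_sheaf \<Rightarrow> 'b cochain1 set set" where
  "H1 X S = cocycles1 X S // cohomologous X S"

definition H1_zero :: "'b topology \<Rightarrow> 'b fun_sheaf \<Rightarrow> 'b cochain1 set" where
  "H1_zero X S = cohomologous X S `` {({topspace X}, \<lambda>_ _ _. 0)}"

definition Cas :: "('a, 'b) nci \<Rightarrow> 'b fun_sheaf" where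
  "Cas N V = {g. casimir (base N) V g}"

definition CasM :: "('a, 'b) nci \<Rightarrow> 'b fun_sheaf" where
  "CasM N V = {g. smooth_on (base N) V g \<and> casimir (total N) (preimage N V) (g \<circ> proj N)}"

definition holonomic_section :: "('a, 'b) nci \<Rightarrow> 'b set \<Rightarrow> ('b \<Rightarrow> 'b covec set) \<Rightarrow> bool" where
  "holonomic_section N V s \<longleftrightarrow> action_section N V s \<and>
     (\<forall>b\<in>V. \<exists>W g. base_open N W \<and> b \<in> W \<and> W \<subseteq> V \<and> g \<in> Cas N W \<and>
        (\<forall>c\<in>W. s c = d_class N g c))"

text \<open>Local lifts of a global section \<open>s\<close> through \<open>[d \<cdot>] : Cas \<rightarrow> E\<^sup>0\<close>; they exist
  exactly if \<open>s\<close> is locally holonomic.\<close>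

definition local_lifts ::
  "('a, 'b) nci \<Rightarrow> ('b \<Rightarrow> 'b covec set) \<Rightarrow> 'b set set \<Rightarrow> ('b set \<Rightarrow> 'b \<Rightarrow> real) \<Rightarrow> bool" where
  "local_lifts N s \<U> g \<longleftrightarrow> open_cover (mtop (base N)) \<U> \<and>
     (\<forall>U\<in>\<U>. g U \<in> Cas N U \<and> (\<forall>b\<in>U. s b = d_class N (g U) b))"

text \<open>The connecting homomorphism: \<open>Obs s\<close> is the class in \<open>H\<^sup>1(B, CasM)\<close> of the cocycle
  \<open>g V - g U\<close>, for any choice of local lifts \<open>g\<close> of \<open>s\<close>. For a global section \<open>s\<close> of \<open>E\<^sup>0\<close>
  all choices of lifts give the same class, so the union is the union of a single set. Outside the
  domain \<open>H\<^sup>0(B, E\<^sup>0)\<close> of the map there are no lifts, and the value is the empty set, which is not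
  an element of \<open>H\<^sup>1(B, CasM)\<close>.\<close>

definition Obs :: "('a, 'b) nci \<Rightarrow> ('b \<Rightarrow> 'b covec set) \<Rightarrow> 'b cochain1 set" where
  "Obs N s = \<Union> {cohomologous (mtop (base N)) (CasM N) `` {(\<U>, \<lambda>U V x. g V x - g U x)} | \<U> g.
     local_lifts N s \<U> g}"

end

theory Submission
  imports Defs
begin

text \<open>
  The theorem compares global Casimir functions with the sections of the action bundle that they
  induce. The heart of the matter is that a global section \<open>s\<close> has zero obstruction exactly if it is
  \<open>[dP]\<close> for a global Casimir function \<open>P\<close> of \<open>\<pi>\<close>
  (\<open>Obs_of_globally_holonomic_section\<close> and \<open>globally_holonomic_if_Obs_zero\<close>). This is the exactness of
  the long cohomology sequence at \<open>H\<^sup>0(B, E\<^sup>0)\<close>, and comes down to the fact that two Casimir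
  functions have the same class exactly if they differ by a section of \<open>Cas\<^sup>M\<close> (\<open>d_class_eq_iff_CasM\<close>).

  Given a trivialization of the lattice sheaf with unobstructed sections \<open>l i\<close>, the global functions
  \<open>p i\<close> with \<open>[dp i] = l i\<close> are therefore action variables. Conversely, if \<open>p\<close> is a set of action
  variables, each lattice section \<open>s\<close> is pointwise an integer combination of the \<open>[dp i]\<close>, and it must be
  shown that the coefficients are locally constant: then the same combination of the functions
  \<open>p i\<close> is a global Casimir function inducing \<open>s\<close>, so that \<open>s\<close> is unobstructed.

  One would usually deduce the continuity of the coefficients from the linear independence of
  a lattice basis over the reals, hence from the discreteness of the period lattices. The argument
  here is topological instead. For a fixed integer vector \<open>\<nu>\<close>, the points where \<open>s\<close> equals the
  combination with coefficients \<open>\<nu>\<close> form a closed set \<open>A \<nu>\<close>, as two sections of the action bundle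
  agree on a closed set (\<open>closedin_equalizer\<close>). By uniqueness of the coefficients, these countably
  many closed sets partition the base. A connected, locally connected, locally compact Hausdorff space has
  no partition into countably many nonempty closed sets except the trivial one (Sierpinski), so
  near each point only one \<open>A \<nu>\<close> occurs (\<open>countable_closed_partition_locally_constant\<close>).

  That sections agree on a closed set uses that the projection \<open>\<phi>\<close> is open
  (\<open>proj_open_map\<close>): a class at \<open>b\<close> may be detected at a single point of the fibre over \<open>b\<close>.
  Openness of \<open>\<phi>\<close> is seen in flat charts, by sliding points along chains of plaques (\<open>nearby_fibres_meet\<close>).
\<close>

section \<open>Smooth functions\<close>

lemma continuous_map_locally:
  assumes "\<And>p. p \<in> topspace X \<Longrightarrow> \<exists>V. openin X V \<and> p \<in> V \<and> continuous_map (subtopology X V) Y f"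
  shows "continuous_map X Y f"
  unfolding continuous_map_eq_topcontinuous_at
proof
  fix p assume p: "p \<in> topspace X"
  obtain V where V: "openin X V" "p \<in> V" "continuous_map (subtopology X V) Y f"
    using assms[OF p] by blast
  have pV: "topspace (subtopology X V) = V"
    using openin_subset[OF V(1)] by auto
  have *: "topcontinuous_at (subtopology X V) Y f p"
    using V pV by (simp add: continuous_map_eq_topcontinuous_at)
  have "\<exists>U. openin X U \<and> p \<in> U \<and> (\<forall>y\<in>U. f y \<in> W)" if W: "openin Y W" "f p \<in> W" for W
  proof -
    obtain U where "openin (subtopology X V) U" "p \<in> U" "\<forall>y\<in>U. f y \<in> W"
      using * W unfolding topcontinuous_at_def by blast
    then show ?thesis
      using openin_trans_full[OF _ V(1)] by blast
  qed
  moreover have "f \<in> topspace X \<rightarrow> topspace Y"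
  proof
    fix q assume "q \<in> topspace X"
    then obtain U where U: "openin X U" "q \<in> U" "continuous_map (subtopology X U) Y f"
      using assms by blast
    then have "q \<in> topspace (subtopology X U)"
      using \<open>q \<in> topspace X\<close> by simp
    then show "f q \<in> topspace Y"
      using continuous_map_image_subset_topspace[OF U(3)] by blast
  qed
  ultimately show "topcontinuous_at X Y f p"
    using p unfolding topcontinuous_at_def by auto
qed

lemma eventually_coordinate_line_in:
  assumes W: "openin (Euclidean_space n) W" and z: "z \<in> W" and i: "i < n"
  shows "\<forall>\<^sub>F t in nhds (z i). z(i := t) \<in> W"
proof -
  have "continuous_map euclideanreal (Euclidean_space n) (\<lambda>t. z(i := t))"
    unfolding Euclidean_space_def continuous_map_in_subtopology continuous_map_componentwise_UNIV
    using openin_subset[OF W] z i by (auto simp: topspace_Euclidean_space)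
  then have "open {t. z(i := t) \<in> W}"
    using W openin_continuous_map_preimage[of euclideanreal "Euclidean_space n" "\<lambda>t. z(i := t)" W]
    by simp
  moreover have "z i \<in> {t. z(i := t) \<in> W}"
    using z by simp
  ultimately show ?thesis
    unfolding eventually_nhds by blast
qed

lemma continuous_map_glue:
  assumes "openin X W"
    and "\<And>z. z \<in> W \<Longrightarrow> \<exists>W' f'. openin X W' \<and> z \<in> W' \<and>
           continuous_map (subtopology X W') Y f' \<and> (\<forall>w\<in>W \<inter> W'. f w = f' w)"
  shows "continuous_map (subtopology X W) Y f"
proof (rule continuous_map_locally)
  fix z assume "z \<in> topspace (subtopology X W)"
  then obtain W' f' where W': "openin X W'" "z \<in> W'" "z \<in> W"
    "continuous_map (subtopology X W') Y f'" "\<forall>w\<in>W \<inter> W'. f w = f' w"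
    using assms(2)[of z] by auto
  have "continuous_map (subtopology X (W \<inter> W')) Y f'"
    using W'(4) continuous_map_from_subtopology_mono by fastforce
  then have "continuous_map (subtopology X (W \<inter> W')) Y f"
    by (rule continuous_map_eq) (use W' in auto)
  then show "\<exists>V. openin (subtopology X W) V \<and> z \<in> V \<and>
      continuous_map (subtopology (subtopology X W) V) Y f"
    using W' assms(1)
    by (intro exI[of _ "W \<inter> W'"]) (auto simp: subtopology_subtopology openin_subtopology_Int2)
qed

lemma Ck_on_continuous: "Ck_on k n W f \<Longrightarrow> continuous_map (subtopology (Euclidean_space n) W) euclideanreal f"
  by (cases k) auto

lemma partial_derivative_germ:
  assumes W: "openin (Euclidean_space n) W" and z: "z \<in> W" and i: "i < n"
    and eq: "\<And>w. w \<in> W \<Longrightarrow> f w = g w"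
  shows "(\<lambda>t. f (z(i := t))) field_differentiable at (z i) \<longleftrightarrow>
           (\<lambda>t. g (z(i := t))) field_differentiable at (z i)"
    and "partial_deriv i f z = partial_deriv i g z"
proof -
  have ev: "\<forall>\<^sub>F t in nhds (z i). f (z(i := t)) = g (z(i := t))"
    using eventually_coordinate_line_in[OF W z i] by eventually_elim (rule eq)
  then have "((\<lambda>t. f (z(i := t))) has_field_derivative D) (at (z i)) \<longleftrightarrow>
        ((\<lambda>t. g (z(i := t))) has_field_derivative D) (at (z i))" for D
    by (intro DERIV_cong_ev) auto
  then show "(\<lambda>t. f (z(i := t))) field_differentiable at (z i) \<longleftrightarrow>
           (\<lambda>t. g (z(i := t))) field_differentiable at (z i)"
    by (simp add: field_differentiable_def)
  show "partial_deriv i f z = partial_deriv i g z"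
    unfolding partial_deriv_def using ev by (intro deriv_cong_ev) auto
qed

text \<open>Smoothness is a local property. The local models are allowed to be functions \<open>f'\<close> that agree with
  \<open>f\<close> only on the overlap, so that restriction to a smaller open set, independence of the values
  outside the domain, and gluing are all instances; the same form is used below for manifolds and for
  Casimir functions.\<close>

lemma Ck_on_glue:
  assumes "openin (Euclidean_space n) W"
    and "\<And>z. z \<in> W \<Longrightarrow> \<exists>W' f'. openin (Euclidean_space n) W' \<and> z \<in> W' \<and> Ck_on k n W' f' \<and>
           (\<forall>w\<in>W \<inter> W'. f w = f' w)"
  shows "Ck_on k n W f"
  using assms
proof (induction k arbitrary: f)
  case 0
  have "continuous_map (subtopology (Euclidean_space n) W) euclideanreal f"
    by (rule continuous_map_glue[OF 0(1)]) (use 0(2) in simp)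
  then show ?case by simp
next
  case (Suc k)
  have "continuous_map (subtopology (Euclidean_space n) W) euclideanreal f"
  proof (rule continuous_map_glue[OF Suc.prems(1)])
    fix z assume "z \<in> W"
    then show "\<exists>W' f'. openin (Euclidean_space n) W' \<and> z \<in> W' \<and>
        continuous_map (subtopology (Euclidean_space n) W') euclideanreal f' \<and> (\<forall>w\<in>W \<inter> W'. f w = f' w)"
      using Suc.prems(2)[of z] Ck_on_continuous[of "Suc k" n] by metis
  qed
  moreover have "(\<lambda>t. f (z(i := t))) field_differentiable at (z i)" if "i < n" "z \<in> W" for i z
  proof -
    obtain W' f' where W': "openin (Euclidean_space n) W'" "z \<in> W'" "Ck_on (Suc k) n W' f'"
      "\<forall>w\<in>W \<inter> W'. f w = f' w"
      using Suc.prems(2) \<open>z \<in> W\<close> by blast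
    have "(\<lambda>t. f' (z(i := t))) field_differentiable at (z i)"
      using W' that by simp
    moreover have "openin (Euclidean_space n) (W \<inter> W')" "z \<in> W \<inter> W'"
      using W' that Suc.prems(1) by auto
    ultimately show ?thesis
      using partial_derivative_germ(1)[of n "W \<inter> W'" z i f f'] W'(4) \<open>i < n\<close> by blast
  qed
  moreover have "Ck_on k n W (partial_deriv i f)" if i: "i < n" for i
  proof (rule Suc.IH[OF Suc.prems(1)])
    fix z assume "z \<in> W"
    then obtain W' f' where W': "openin (Euclidean_space n) W'" "z \<in> W'" "Ck_on (Suc k) n W' f'"
      "\<forall>w\<in>W \<inter> W'. f w = f' w"
      using Suc.prems(2) by blast
    have "\<forall>w\<in>W \<inter> W'. partial_deriv i f w = partial_deriv i f' w"
      using partial_derivative_germ(2)[of n "W \<inter> W'" _ i f f'] W'(4) i openin_Int[OF Suc.prems(1) W'(1)]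
      by blast
    moreover have "Ck_on k n W' (partial_deriv i f')"
      using W'(3) i by simp
    ultimately show "\<exists>W' f'. openin (Euclidean_space n) W' \<and> z \<in> W' \<and> Ck_on k n W' f' \<and>
                 (\<forall>w\<in>W \<inter> W'. partial_deriv i f w = f' w)"
      using W'(1,2) by (intro exI[of _ W'] exI[of _ "partial_deriv i f'"]) simp
  qed
  ultimately show ?case by simp
qed

lemma Ck_on_lincomb:
  assumes "openin (Euclidean_space n) W" "Ck_on k n W f" "Ck_on k n W g"
  shows "Ck_on k n W (\<lambda>z. a * f z + b * g z)"
  using assms
proof (induction k arbitrary: f g)
  case 0
  have "continuous_map (subtopology (Euclidean_space n) W) euclideanreal (\<lambda>z. a * f z + b * g z)"
    by (intro continuous_map_add continuous_map_real_mult_left) (use 0 in simp_all)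
  then show ?case by simp
next
  case (Suc k)
  have "Ck_on k n W (partial_deriv i (\<lambda>z. a * f z + b * g z))" if i: "i < n" for i
  proof (rule Ck_on_glue[OF Suc.prems(1)])
    fix z assume "z \<in> W"
    have "partial_deriv i (\<lambda>z. a * f z + b * g z) w
        = a * partial_deriv i f w + b * partial_deriv i g w" if "w \<in> W" for w
    proof -
      have "(\<lambda>t. f (w(i := t))) field_differentiable at (w i)"
        "(\<lambda>t. g (w(i := t))) field_differentiable at (w i)"
        using Suc.prems i that by simp_all
      then show ?thesis
        unfolding partial_deriv_def
        by (intro DERIV_imp_deriv DERIV_add DERIV_cmult)
          (simp_all add: DERIV_deriv_iff_field_differentiable)
    qed
    moreover have "Ck_on k n W (\<lambda>w. a * partial_deriv i f w + b * partial_deriv i g w)"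
      using Suc i by simp
    ultimately show "\<exists>W' f'. openin (Euclidean_space n) W' \<and> z \<in> W' \<and> Ck_on k n W' f' \<and>
        (\<forall>w\<in>W \<inter> W'. partial_deriv i (\<lambda>z. a * f z + b * g z) w = f' w)"
      using Suc.prems(1) \<open>z \<in> W\<close>
      by (intro exI[of _ W] exI[of _ "\<lambda>w. a * partial_deriv i f w + b * partial_deriv i g w"]) simp
  qed
  moreover have "(\<lambda>t. a * f (z(i := t)) + b * g (z(i := t))) field_differentiable at (z i)"
    if "i < n" "z \<in> W" for i z
  proof -
    have "(\<lambda>t. f (z(i := t))) field_differentiable at (z i)"
      "(\<lambda>t. g (z(i := t))) field_differentiable at (z i)"
      using Suc.prems that by simp_all
    then show ?thesis
      by (intro field_differentiable_add field_differentiable_mult field_differentiable_const)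
  qed
  moreover have "continuous_map (subtopology (Euclidean_space n) W) euclideanreal (\<lambda>z. a * f z + b * g z)"
    using Suc.prems(2,3)[THEN Ck_on_continuous]
    by (intro continuous_map_add continuous_map_real_mult_left)
  ultimately show ?case by simp
qed

lemma Ck_on_const: "Ck_on k n W (\<lambda>_. c)"
proof (induction k arbitrary: c)
  case (Suc k)
  have "partial_deriv i (\<lambda>_. c) = (\<lambda>_. 0)" for i
    by (simp add: partial_deriv_def fun_eq_iff)
  then show ?case using Suc by simp
qed simp

lemma atlas_chart:
  assumes "smooth_manifold M" "(U, x) \<in> matlas M"
  shows "openin (mtop M) U" "openin (Euclidean_space (mdim M)) (x ` U)" "inj_on x U"
    "homeomorphic_map (subtopology (mtop M) U) (subtopology (Euclidean_space (mdim M)) (x ` U)) x"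
proof -
  have "is_chart (mtop M) (mdim M) (U, x)"
    using assms unfolding smooth_manifold_def by blast
  then show *: "openin (mtop M) U" "openin (Euclidean_space (mdim M)) (x ` U)"
    "homeomorphic_map (subtopology (mtop M) U) (subtopology (Euclidean_space (mdim M)) (x ` U)) x"
    unfolding is_chart_def by auto
  have "topspace (subtopology (mtop M) U) = U"
    using openin_subset[OF *(1)] by auto
  then show "inj_on x U"
    using *(3) unfolding homeomorphic_eq_everything_map by auto
qed

lemma atlas_covers:
  assumes "smooth_manifold M" "p \<in> topspace (mtop M)"
  obtains U x where "(U, x) \<in> matlas M" "p \<in> U"
  using assms unfolding smooth_manifold_def by (metis UN_E prod.collapse)

lemma chart_image_open:
  assumes "smooth_manifold M" "(U, x) \<in> matlas M" "openin (mtop M) V"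
  shows "openin (Euclidean_space (mdim M)) (x ` (U \<inter> V))"
proof -
  note c = atlas_chart[OF assms(1,2)]
  have "openin (subtopology (mtop M) U) (U \<inter> V)"
    using assms(3) by (simp add: openin_subtopology_Int2)
  then have "openin (subtopology (Euclidean_space (mdim M)) (x ` U)) (x ` (U \<inter> V))"
    using c(4) homeomorphic_map_openness_eq by blast
  then show ?thesis
    using c(2) openin_trans_full by blast
qed

lemma smooth_on_openin: "smooth_on M V f \<Longrightarrow> openin (mtop M) V"
  by (simp add: smooth_on_def)

lemma smooth_on_glue:
  assumes M: "smooth_manifold M" and V: "openin (mtop M) V"
    and loc: "\<And>p. p \<in> V \<Longrightarrow> \<exists>V' f'. p \<in> V' \<and> smooth_on M V' f' \<and> (\<forall>q\<in>V \<inter> V'. f q = f' q)"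
  shows "smooth_on M V f"
proof -
  have "Cinf_on (mdim M) (x ` (U \<inter> V)) (\<lambda>z. f (inv_into U x z))" if Ux: "(U, x) \<in> matlas M" for U x
    unfolding Cinf_on_def
  proof (intro allI Ck_on_glue chart_image_open[OF M Ux V])
    fix k z assume "z \<in> x ` (U \<inter> V)"
    then obtain p where p: "p \<in> U" "p \<in> V" "z = x p" by auto
    then obtain V' f' where V': "p \<in> V'" "smooth_on M V' f'" "\<forall>q\<in>V \<inter> V'. f q = f' q"
      using loc by blast
    have "Ck_on k (mdim M) (x ` (U \<inter> V')) (\<lambda>z. f' (inv_into U x z))"
      using V'(2) Ux unfolding smooth_on_def Cinf_on_def by blast
    moreover have "f (inv_into U x w) = f' (inv_into U x w)"
      if "w \<in> x ` (U \<inter> V) \<inter> x ` (U \<inter> V')" for w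
      using that V'(3) atlas_chart(3)[OF M Ux] by (auto simp: inj_on_eq_iff)
    moreover have "openin (Euclidean_space (mdim M)) (x ` (U \<inter> V'))" "z \<in> x ` (U \<inter> V')"
      using chart_image_open[OF M Ux] smooth_on_openin[OF V'(2)] V'(1) p by auto
    ultimately show "\<exists>W' f'. openin (Euclidean_space (mdim M)) W' \<and> z \<in> W' \<and> Ck_on k (mdim M) W' f' \<and>
        (\<forall>w\<in>x ` (U \<inter> V) \<inter> W'. f (inv_into U x w) = f' w)"
      by (intro exI[of _ "x ` (U \<inter> V')"] exI[of _ "\<lambda>z. f' (inv_into U x z)"]) blast
  qed
  then show ?thesis
    using V unfolding smooth_on_def by blast
qed

lemma smooth_on_mono:
  assumes "smooth_manifold M" "smooth_on M V f" "openin (mtop M) V'" "V' \<subseteq> V"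
  shows "smooth_on M V' f"
  by (rule smooth_on_glue[OF assms(1,3)]) (use assms in blast)

lemma smooth_on_lincomb:
  assumes M: "smooth_manifold M" and "smooth_on M V f" "smooth_on M V g"
  shows "smooth_on M V (\<lambda>p. a * f p + b * g p)"
proof -
  have V: "openin (mtop M) V"
    using assms(2) by (rule smooth_on_openin)
  have "Ck_on k (mdim M) (x ` (U \<inter> V)) (\<lambda>z. a * f (inv_into U x z) + b * g (inv_into U x z))"
    if "(U, x) \<in> matlas M" for U x k
    by (rule Ck_on_lincomb[OF chart_image_open[OF M that V]])
      (use assms that in \<open>auto simp: smooth_on_def Cinf_on_def\<close>)
  then show ?thesis
    using V unfolding smooth_on_def Cinf_on_def by blast
qed

lemma smooth_on_const: "openin (mtop M) V \<Longrightarrow> smooth_on M V (\<lambda>_. c)"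
  unfolding smooth_on_def Cinf_on_def using Ck_on_const by blast

lemma smooth_on_coordinate:
  assumes M: "smooth_manifold M" and Ux: "(U, x) \<in> matlas M" and j: "j < mdim M"
  shows "smooth_on M U (\<lambda>p. x p j)"
proof -
  have "smooth_transition (mdim M) (V, y) (U, x)" if "(V, y) \<in> matlas M" for V y
    using M Ux that unfolding smooth_manifold_def by blast
  then show ?thesis
    using atlas_chart(1)[OF M Ux] j unfolding smooth_on_def smooth_transition_def by auto
qed

lemma smooth_on_continuous:
  assumes M: "smooth_manifold M" and f: "smooth_on M V f"
  shows "continuous_map (subtopology (mtop M) V) euclideanreal f"
proof (rule continuous_map_glue[OF smooth_on_openin[OF f]])
  fix p assume p: "p \<in> V"
  note V = smooth_on_openin[OF f]
  then obtain U x where Ux: "(U, x) \<in> matlas M" "p \<in> U"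
    using atlas_covers[OF M] p openin_subset by blast
  note c = atlas_chart[OF M Ux(1)]
  let ?E = "Euclidean_space (mdim M)"
  have "continuous_map (subtopology ?E (x ` (U \<inter> V))) euclideanreal (\<lambda>z. f (inv_into U x z))"
    using f Ux(1) Ck_on_continuous unfolding smooth_on_def Cinf_on_def by blast
  moreover have "continuous_map (subtopology (mtop M) (U \<inter> V)) (subtopology ?E (x ` (U \<inter> V))) x"
  proof -
    have "continuous_map (subtopology (mtop M) U) ?E x"
      using c(4) homeomorphic_imp_continuous_map continuous_map_in_subtopology by blast
    then have "continuous_map (subtopology (mtop M) (U \<inter> V)) ?E x"
      using continuous_map_from_subtopology_mono by fastforce
    then show ?thesis
      by (auto simp: continuous_map_in_subtopology)
  qed
  ultimately have "continuous_map (subtopology (mtop M) (U \<inter> V)) euclideanreal ((\<lambda>z. f (inv_into U x z)) \<circ> x)"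
    using continuous_map_compose by blast
  then show "\<exists>W' f'. openin (mtop M) W' \<and> p \<in> W' \<and>
      continuous_map (subtopology (mtop M) W') euclideanreal f' \<and> (\<forall>w\<in>V \<inter> W'. f w = f' w)"
    using p Ux c V by (intro exI[of _ "U \<inter> V"] exI[of _ "(\<lambda>z. f (inv_into U x z)) \<circ> x"]) auto
qed

lemma smooth_at_lincomb:
  assumes M: "smooth_manifold M" and "smooth_at M m f" "smooth_at M m g"
  shows "smooth_at M m (\<lambda>p. a * f p + b * g p)"
proof -
  obtain V W where "m \<in> V" "smooth_on M V f" "m \<in> W" "smooth_on M W g"
    using assms unfolding smooth_at_def by blast
  moreover from this have "smooth_on M (V \<inter> W) f" "smooth_on M (V \<inter> W) g"
    using smooth_on_mono[OF M] smooth_on_openin by (meson openin_Int inf_le1 inf_le2)+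
  ultimately show ?thesis
    using smooth_on_lincomb[OF M] unfolding smooth_at_def by blast
qed

section \<open>The topology of a manifold\<close>

lemma locally_connected_manifold:
  assumes M: "smooth_manifold M"
  shows "locally_connected_space (mtop M)"
  unfolding locally_connected_space
proof (intro allI impI, elim conjE)
  fix V p assume V: "openin (mtop M) V" "p \<in> V"
  then obtain U x where Ux: "(U, x) \<in> matlas M" "p \<in> U"
    using atlas_covers[OF M] openin_subset by blast
  note c = atlas_chart[OF M Ux(1)]
  have "locally_connected_space (subtopology (mtop M) U)"
    using homeomorphic_locally_connected_space[OF homeomorphic_map_imp_homeomorphic_space[OF c(4)]]
      locally_connected_space_open_subset[OF locally_connected_Euclidean_space c(2)] by simp
  moreover have "openin (subtopology (mtop M) U) (U \<inter> V)"
    using V by (simp add: openin_subtopology_Int2)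
  ultimately obtain Q where "openin (subtopology (mtop M) U) Q"
    "connectedin (subtopology (mtop M) U) Q" "p \<in> Q" "Q \<subseteq> U \<inter> V"
    using V(2) Ux(2) unfolding locally_connected_space by blast
  then show "\<exists>Q. openin (mtop M) Q \<and> connectedin (mtop M) Q \<and> p \<in> Q \<and> Q \<subseteq> V"
    using openin_trans_full[OF _ c(1)] by (intro exI[of _ Q]) (auto simp: connectedin_subtopology)
qed

lemma locally_compact_manifold:
  assumes M: "smooth_manifold M"
  shows "locally_compact_space (mtop M)"
  unfolding locally_compact_space_def
proof
  fix p assume "p \<in> topspace (mtop M)"
  then obtain U x where Ux: "(U, x) \<in> matlas M" "p \<in> U"
    using atlas_covers[OF M] by blast
  note c = atlas_chart[OF M Ux(1)]
  have "locally_compact_space (subtopology (mtop M) U)"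
    using homeomorphic_locally_compact_space[OF homeomorphic_map_imp_homeomorphic_space[OF c(4)]]
      locally_compact_space_open_subset[OF _ locally_compact_Euclidean_space c(2)]
      Hausdorff_Euclidean_space by blast
  moreover have "p \<in> topspace (subtopology (mtop M) U)"
    using Ux \<open>p \<in> topspace (mtop M)\<close> by simp
  ultimately obtain Q K where "openin (subtopology (mtop M) U) Q"
    "compactin (subtopology (mtop M) U) K" "p \<in> Q" "Q \<subseteq> K"
    unfolding locally_compact_space_def by blast
  then show "\<exists>Q K. openin (mtop M) Q \<and> compactin (mtop M) K \<and> p \<in> Q \<and> Q \<subseteq> K"
    using openin_trans_full[OF _ c(1)] by (intro exI[of _ Q] exI[of _ K]) (auto simp: compactin_subtopology)
qed

text \<open>By Sierpinski's theorem, a connected, locally connected and locally compact Hausdorff space is not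
  the disjoint union of two or more, but countably many, nonempty closed sets. Applied to a connected
  neighbourhood of a point, this turns closedness of the members of a countable partition into
  openness.\<close>

lemma countable_closed_partition_locally_constant:
  assumes "locally_connected_space X" "locally_compact_space X" "Hausdorff_space X"
    and I: "countable I" and cl: "\<And>i. i \<in> I \<Longrightarrow> closedin X (A i)"
    and dj: "\<And>i j p. i \<in> I \<Longrightarrow> j \<in> I \<Longrightarrow> p \<in> A i \<Longrightarrow> p \<in> A j \<Longrightarrow> i = j"
    and cov: "\<And>p. p \<in> topspace X \<Longrightarrow> \<exists>i\<in>I. p \<in> A i"
    and p: "p \<in> topspace X"
  shows "\<exists>Q i. openin X Q \<and> p \<in> Q \<and> i \<in> I \<and> Q \<subseteq> A i"
proof -
  obtain Q where Q: "openin X Q" "connectedin X Q" "p \<in> Q"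
    using assms(1) p unfolding locally_connected_space by (meson openin_topspace)
  have topQ: "topspace (subtopology X Q) = Q"
    using openin_subset[OF Q(1)] by auto
  define \<U> where "\<U> = (\<lambda>i. Q \<inter> A i) ` {i \<in> I. Q \<inter> A i \<noteq> {}}"
  have "\<U> = {topspace (subtopology X Q)}"
  proof (rule locally_connected_not_countable_closed_union)
    show "topspace (subtopology X Q) \<noteq> {}" using Q topQ by auto
    show "connected_space (subtopology X Q)" using Q(2) connectedin_def by blast
    show "locally_connected_space (subtopology X Q)"
      using locally_connected_space_open_subset assms(1) Q(1) by blast
    show "completely_metrizable_space (subtopology X Q) \<or>
        locally_compact_space (subtopology X Q) \<and> Hausdorff_space (subtopology X Q)"
      using locally_compact_space_open_subset Hausdorff_space_subtopology assms(2,3) Q(1) by blast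
    show "countable \<U>" unfolding \<U>_def using I by simp
    show "pairwise disjnt \<U>"
      unfolding \<U>_def pairwise_def disjnt_def using dj by blast
    show "closedin (subtopology X Q) C \<and> C \<noteq> {}" if "C \<in> \<U>" for C
      using that cl unfolding \<U>_def by (auto simp: closedin_subtopology_Int_closed)
    show "\<Union>\<U> = topspace (subtopology X Q)"
    proof -
      have "\<exists>i\<in>I. q \<in> A i" if "q \<in> Q" for q
        using cov openin_subset[OF Q(1)] that by blast
      then show ?thesis
        unfolding topQ \<U>_def by fastforce
    qed
  qed
  then have "Q \<in> \<U>" using topQ by auto
  then show ?thesis
    using Q unfolding \<U>_def by blast
qed

section \<open>Differentials, Hamiltonian vector fields and Casimir functions\<close>

lemma smooth_at_const: "m \<in> topspace (mtop M) \<Longrightarrow> smooth_at M m (\<lambda>_. c)"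
  unfolding smooth_at_def using smooth_on_const by blast

lemma smooth_at_cmult:
  assumes "smooth_manifold M" "smooth_at M m f"
  shows "smooth_at M m (\<lambda>p. a * f p)"
  using smooth_at_lincomb[OF assms assms(2), of a 0] by simp

lemma tangent_space_derivation:
  assumes "v \<in> tangent_space M m"
  shows "\<not> smooth_at M m f \<Longrightarrow> v f = 0"
    and "m \<in> V \<Longrightarrow> smooth_on M V f \<Longrightarrow> (\<And>p. p \<in> V \<Longrightarrow> f p = g p) \<Longrightarrow> v f = v g"
    and "smooth_at M m f \<Longrightarrow> smooth_at M m g \<Longrightarrow> v (\<lambda>p. f p + g p) = v f + v g"
    and "smooth_at M m f \<Longrightarrow> v (\<lambda>p. c * f p) = c * v f"
    and "smooth_at M m f \<Longrightarrow> smooth_at M m g \<Longrightarrow> v (\<lambda>p. f p * g p) = f m * v g + g m * v f"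
proof -
  note v = assms[unfolded tangent_space_def mem_Collect_eq]
  show "\<not> smooth_at M m f \<Longrightarrow> v f = 0"
    using v[THEN conjunct1] by blast
  show "m \<in> V \<Longrightarrow> smooth_on M V f \<Longrightarrow> (\<And>p. p \<in> V \<Longrightarrow> f p = g p) \<Longrightarrow> v f = v g"
    using v[THEN conjunct2, THEN conjunct1, rule_format, of V f g] by blast
  show "smooth_at M m f \<Longrightarrow> smooth_at M m g \<Longrightarrow> v (\<lambda>p. f p + g p) = v f + v g"
    by (rule v[THEN conjunct2, THEN conjunct2, THEN conjunct1, rule_format]) blast
  show "smooth_at M m f \<Longrightarrow> v (\<lambda>p. c * f p) = c * v f"
    by (rule v[THEN conjunct2, THEN conjunct2, THEN conjunct2, THEN conjunct1, rule_format])
  show "smooth_at M m f \<Longrightarrow> smooth_at M m g \<Longrightarrow> v (\<lambda>p. f p * g p) = f m * v g + g m * v f"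
    by (rule v[THEN conjunct2, THEN conjunct2, THEN conjunct2, THEN conjunct2, rule_format]) blast
qed

lemma tangent_space_add:
  assumes v: "v \<in> tangent_space M m" and w: "w \<in> tangent_space M m"
  shows "(\<lambda>f. v f + w f) \<in> tangent_space M m"
proof -
  have "v f + w f = v g + w g" if "m \<in> V" "smooth_on M V f" "\<forall>p\<in>V. f p = g p" for V f g
    using tangent_space_derivation(2)[OF v that(1,2), of g] tangent_space_derivation(2)[OF w that(1,2), of g] that(3)
    by simp
  then show ?thesis
    unfolding tangent_space_def mem_Collect_eq
    using tangent_space_derivation(1,3,4,5)[OF v] tangent_space_derivation(1,3,4,5)[OF w]
    by (intro conjI allI impI; (elim conjE)?; simp add: algebra_simps)
qed

lemma tangent_space_scale:
  assumes v: "v \<in> tangent_space M m"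
  shows "(\<lambda>f. a * v f) \<in> tangent_space M m"
proof -
  have "a * v f = a * v g" if "m \<in> V" "smooth_on M V f" "\<forall>p\<in>V. f p = g p" for V f g
    using tangent_space_derivation(2)[OF v that(1,2), of g] that(3) by simp
  then show ?thesis
    unfolding tangent_space_def mem_Collect_eq
    using tangent_space_derivation(1,3,4,5)[OF v]
    by (intro conjI allI impI; (elim conjE)?; simp add: algebra_simps)
qed

lemma differential_in_cotangent_space: "differential M f m \<in> cotangent_space M m"
  unfolding cotangent_space_def differential_def
  by (simp add: tangent_space_add tangent_space_scale)

lemma cotangent_space_lincomb:
  assumes "\<xi> \<in> cotangent_space M m" "\<eta> \<in> cotangent_space M m"
  shows "(\<lambda>v. a * \<xi> v + b * \<eta> v) \<in> cotangent_space M m"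
  using assms unfolding cotangent_space_def by (simp add: algebra_simps)

lemma cotangent_space_scale: "\<xi> \<in> cotangent_space M m \<Longrightarrow> (\<lambda>v. a * \<xi> v) \<in> cotangent_space M m"
  using cotangent_space_lincomb[of \<xi> M m \<xi> a 0] by simp

lemma differential_germ:
  assumes "smooth_on M V f" "m \<in> V" "\<And>p. p \<in> V \<Longrightarrow> f p = g p"
  shows "differential M f m = differential M g m"
  unfolding differential_def fun_eq_iff using tangent_space_derivation(2)[OF _ assms(2,1,3)] by simp

lemma differential_lincomb:
  assumes "smooth_manifold M" "smooth_at M m f" "smooth_at M m g"
  shows "differential M (\<lambda>p. a * f p + b * g p) m
    = (\<lambda>v. a * differential M f m v + b * differential M g m v)"
proof -
  have "v (\<lambda>p. a * f p + b * g p) = a * v f + b * v g" if v: "v \<in> tangent_space M m" for v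
    using tangent_space_derivation(3)[OF v smooth_at_cmult[OF assms(1,2), of a] smooth_at_cmult[OF assms(1,3), of b]]
    by (simp add: tangent_space_derivation(4)[OF v] assms)
  then show ?thesis
    by (auto simp: differential_def fun_eq_iff)
qed

lemma differential_zero:
  assumes "m \<in> topspace (mtop M)"
  shows "differential M (\<lambda>_. 0) m = (\<lambda>_. 0)"
proof -
  have "v (\<lambda>_. 0) = 0" if "v \<in> tangent_space M m" for v
    using tangent_space_derivation(4)[OF that smooth_at_const[OF assms, of 0], of 0] by simp
  then show ?thesis
    by (simp add: differential_def fun_eq_iff)
qed

lemma poisson_manifold_smooth: "poisson_manifold M \<Longrightarrow> smooth_manifold M"
  by (simp add: poisson_manifold_def)

lemma bivector_antisym:
  assumes "poisson_manifold M" "m \<in> topspace (mtop M)"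
    and "\<xi> \<in> cotangent_space M m" "\<eta> \<in> cotangent_space M m"
  shows "bivector M m \<xi> \<eta> = - bivector M m \<eta> \<xi>"
  using assms unfolding poisson_manifold_def by blast

lemma bivector_lincomb:
  assumes M: "poisson_manifold M" "m \<in> topspace (mtop M)"
    and \<xi>: "\<xi> \<in> cotangent_space M m" and \<eta>: "\<eta> \<in> cotangent_space M m" and \<zeta>: "\<zeta> \<in> cotangent_space M m"
  shows "bivector M m (\<lambda>v. a * \<xi> v + b * \<eta> v) \<zeta> = a * bivector M m \<xi> \<zeta> + b * bivector M m \<eta> \<zeta>"
proof -
  note laws = M(1)[unfolded poisson_manifold_def, THEN conjunct2, THEN conjunct1, THEN bspec, OF M(2),
      THEN bspec, THEN bspec]
  have scale: "bivector M m (\<lambda>v. c * \<xi> v) \<zeta> = c * bivector M m \<xi> \<zeta>" if "\<xi> \<in> cotangent_space M m" for c \<xi>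
    using laws[OF that \<zeta>] by blast
  have add: "bivector M m (\<lambda>v. \<xi> v + \<eta> v) \<zeta> = bivector M m \<xi> \<zeta> + bivector M m \<eta> \<zeta>"
    if "\<xi> \<in> cotangent_space M m" "\<eta> \<in> cotangent_space M m" for \<xi> \<eta>
    using laws[OF that] \<zeta> by blast
  show ?thesis
    using add[OF cotangent_space_scale[OF \<xi>, of a] cotangent_space_scale[OF \<eta>, of b]]
    by (simp add: scale[OF \<xi>] scale[OF \<eta>])
qed

lemma sharp_lincomb:
  assumes "poisson_manifold M" "m \<in> topspace (mtop M)"
    and "\<xi> \<in> cotangent_space M m" "\<eta> \<in> cotangent_space M m"
  shows "sharp M m (\<lambda>v. a * \<xi> v + b * \<eta> v) = (\<lambda>g. a * sharp M m \<xi> g + b * sharp M m \<eta> g)"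
  using bivector_lincomb[OF assms differential_in_cotangent_space]
  by (simp add: sharp_def fun_eq_iff)

lemma zero_in_cotangent_space: "(\<lambda>_. 0) \<in> cotangent_space M m"
  by (simp add: cotangent_space_def)

lemma sharp_zero:
  assumes "poisson_manifold M" "m \<in> topspace (mtop M)"
  shows "sharp M m (\<lambda>_. 0) = (\<lambda>_. 0)"
  using sharp_lincomb[OF assms zero_in_cotangent_space zero_in_cotangent_space, of 0 0] by simp

lemma sharp_sum:
  assumes M: "poisson_manifold M" "m \<in> topspace (mtop M)"
    and "\<And>i. i < k \<Longrightarrow> \<xi> i \<in> cotangent_space M m"
  shows "(\<lambda>v. \<Sum>i<k. c i * \<xi> i v) \<in> cotangent_space M m \<and>
    sharp M m (\<lambda>v. \<Sum>i<k. c i * \<xi> i v) = (\<lambda>g. \<Sum>i<(k::nat). c i * sharp M m (\<xi> i) g)"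
  using assms(3)
proof (induction k)
  case 0
  then show ?case using sharp_zero[OF M] zero_in_cotangent_space by simp
next
  case (Suc k)
  then have IH: "(\<lambda>v. \<Sum>i<k. c i * \<xi> i v) \<in> cotangent_space M m"
    "sharp M m (\<lambda>v. \<Sum>i<k. c i * \<xi> i v) = (\<lambda>g. \<Sum>i<k. c i * sharp M m (\<xi> i) g)"
    and k: "\<xi> k \<in> cotangent_space M m" by auto
  show ?case
    using sharp_lincomb[OF M IH(1) k, of 1 "c k"] cotangent_space_lincomb[OF IH(1) k, of 1 "c k"] IH(2)
    by simp
qed

lemma sharp_differential:
  "sharp M m (differential M f m) = (\<lambda>g. if smooth_at M m g then bracket M f g m else 0)"
  by (auto simp: sharp_def bracket_def)

text \<open>Since \<open>X\<^sub>f = - \<Pi>\<^sup>\<sharp>(df)\<close>, being a Casimir function is a linear condition on \<open>df\<close>. This form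
  can be compared directly with the two kernels that define the action bundle.\<close>

lemma casimir_iff_sharp:
  assumes M: "poisson_manifold M"
  shows "casimir M V f \<longleftrightarrow>
    smooth_on M V f \<and> (\<forall>m\<in>V. sharp M m (differential M f m) = (\<lambda>_. 0))"
proof -
  have "hamiltonian M f m = (\<lambda>g. - sharp M m (differential M f m) g)"
    if "smooth_on M V f" "m \<in> V" for m
  proof -
    have "m \<in> topspace (mtop M)"
      using smooth_on_openin[OF that(1)] openin_subset that(2) by blast
    then have "bracket M g f m = - bracket M f g m" for g
      unfolding bracket_def
      using bivector_antisym[OF M _ differential_in_cotangent_space differential_in_cotangent_space] by blast
    then show ?thesis
      by (simp add: hamiltonian_def sharp_differential fun_eq_iff)
  qed
  then show ?thesis
    unfolding casimir_def by (auto simp: fun_eq_iff)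
qed

lemma casimir_smooth_on: "casimir M V f \<Longrightarrow> smooth_on M V f"
  by (simp add: casimir_def)

lemma casimir_glue:
  assumes M: "poisson_manifold M" and V: "openin (mtop M) V"
    and loc: "\<And>p. p \<in> V \<Longrightarrow> \<exists>V' f'. p \<in> V' \<and> casimir M V' f' \<and> (\<forall>q\<in>V \<inter> V'. f q = f' q)"
  shows "casimir M V f"
  unfolding casimir_iff_sharp[OF M]
proof (intro conjI ballI)
  note M' = poisson_manifold_smooth[OF M]
  show "smooth_on M V f"
    using smooth_on_glue[OF M' V] loc casimir_smooth_on by metis
  fix p assume p: "p \<in> V"
  then obtain V' f' where V': "p \<in> V'" "casimir M V' f'" "\<forall>q\<in>V \<inter> V'. f q = f' q"
    using loc by blast
  have "smooth_on M (V \<inter> V') f"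
    by (rule smooth_on_mono[OF M' \<open>smooth_on M V f\<close> openin_Int[OF V smooth_on_openin[OF casimir_smooth_on[OF V'(2)]]]])
      simp
  then have "differential M f p = differential M f' p"
    using differential_germ[of M "V \<inter> V'" f p f'] p V' by blast
  then show "sharp M p (differential M f p) = (\<lambda>_. 0)"
    using V' unfolding casimir_iff_sharp[OF M] by auto
qed

lemma casimir_mono:
  assumes "poisson_manifold M" "casimir M V f" "openin (mtop M) V'" "V' \<subseteq> V"
  shows "casimir M V' f"
  by (rule casimir_glue[OF assms(1,3)]) (use assms in blast)

lemma casimir_zero:
  assumes M: "poisson_manifold M" and V: "openin (mtop M) V"
  shows "casimir M V (\<lambda>_. 0)"
  using smooth_on_const[OF V] openin_subset[OF V] sharp_zero[OF M] differential_zero[of _ M]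
  unfolding casimir_iff_sharp[OF M] by auto

lemma smooth_on_imp_smooth_at: "smooth_on M V f \<Longrightarrow> m \<in> V \<Longrightarrow> smooth_at M m f"
  unfolding smooth_at_def by blast

lemma casimir_lincomb:
  assumes M: "poisson_manifold M" and f: "casimir M V f" and g: "casimir M V g"
  shows "casimir M V (\<lambda>p. a * f p + b * g p)"
  unfolding casimir_iff_sharp[OF M]
proof (intro conjI ballI)
  note M' = poisson_manifold_smooth[OF M]
  note s = casimir_smooth_on[OF f] casimir_smooth_on[OF g]
  show "smooth_on M V (\<lambda>p. a * f p + b * g p)"
    by (rule smooth_on_lincomb[OF M' s])
  fix m assume m: "m \<in> V"
  then have "m \<in> topspace (mtop M)"
    using s(1) smooth_on_openin openin_subset by blast
  then show "sharp M m (differential M (\<lambda>p. a * f p + b * g p) m) = (\<lambda>_. 0)"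
    using f g m s[THEN smooth_on_imp_smooth_at, OF m] unfolding casimir_iff_sharp[OF M]
    by (simp add: differential_lincomb[OF M'] sharp_lincomb[OF M] differential_in_cotangent_space)
qed

lemma casimir_sum:
  assumes M: "poisson_manifold M" and V: "openin (mtop M) V" and f: "\<And>i. i < k \<Longrightarrow> casimir M V (f i)"
  shows "casimir M V (\<lambda>p. \<Sum>i<(k::nat). c i * f i p) \<and>
    (\<forall>m\<in>V. differential M (\<lambda>p. \<Sum>i<k. c i * f i p) m = (\<lambda>v. \<Sum>i<k. c i * differential M (f i) m v))"
  using f
proof (induction k)
  case 0
  then show ?case
    using casimir_zero[OF M V] differential_zero[of _ M] openin_subset[OF V] by auto
next
  case (Suc k)
  let ?F = "\<lambda>p. \<Sum>i<k. c i * f i p"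
  have IH: "casimir M V ?F"
    "\<And>m. m \<in> V \<Longrightarrow> differential M ?F m = (\<lambda>v. \<Sum>i<k. c i * differential M (f i) m v)"
    and k: "casimir M V (f k)"
    using Suc by auto
  have "casimir M V (\<lambda>p. 1 * ?F p + c k * f k p)"
    by (rule casimir_lincomb[OF M IH(1) k])
  moreover have "differential M (\<lambda>p. 1 * ?F p + c k * f k p) m
      = (\<lambda>v. 1 * differential M ?F m v + c k * differential M (f k) m v)" if "m \<in> V" for m
    by (rule differential_lincomb[OF poisson_manifold_smooth[OF M]
          smooth_on_imp_smooth_at[OF casimir_smooth_on[OF IH(1)] that]
          smooth_on_imp_smooth_at[OF casimir_smooth_on[OF k] that]])
  ultimately show ?case
    using IH(2) by simp
qed

section \<open>The projection onto the leaf space\<close>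

locale nci_fibration =
  fixes N :: "('a, 'b) nci"
  assumes nci: "nci_system N"
begin

abbreviation "M \<equiv> total N"
abbreviation "B \<equiv> base N"
abbreviation "\<phi> \<equiv> proj N"

lemma poisson_total: "poisson_manifold M"
  using nci unfolding nci_system_def abstract_nci_def by blast

lemma poisson_base: "poisson_manifold B"
  using nci unfolding nci_system_def by blast

lemma foliation_by_fibres: "foliation M (nci_rank N) (fibre N ` base_space N)"
  using nci unfolding nci_system_def abstract_nci_def by blast

lemma quotient: "quotient_map (mtop M) (mtop B) \<phi>"
  using nci unfolding nci_system_def by blast

lemma submersion: "submersion M B \<phi>"
  using nci unfolding nci_system_def by blast

lemma poisson_map: "poisson_map M B \<phi>"
  using nci unfolding nci_system_def by blast

lemmas smooth_total = poisson_manifold_smooth[OF poisson_total]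
lemmas smooth_base = poisson_manifold_smooth[OF poisson_base]

lemma proj_surj: "\<phi> ` topspace (mtop M) = base_space N"
  using quotient quotient_imp_surjective_map by blast

lemma base_point_lift:
  assumes "b \<in> base_space N"
  obtains m where "m \<in> topspace (mtop M)" "\<phi> m = b"
  using assms proj_surj by (metis imageE)

lemma proj_in_base: "m \<in> topspace (mtop M) \<Longrightarrow> \<phi> m \<in> base_space N"
  using proj_surj by blast

lemma openin_preimage: "base_open N V \<Longrightarrow> openin (mtop M) (preimage N V)"
  using quotient_imp_continuous_map[OF quotient] unfolding preimage_def by (rule openin_continuous_map_preimage)

lemma smooth_on_comp_proj: "smooth_on B V f \<Longrightarrow> smooth_on M (preimage N V) (f \<circ> \<phi>)"
  using submersion unfolding submersion_def smooth_map_def preimage_def by blast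

lemma smooth_at_comp_proj:
  assumes "m \<in> topspace (mtop M)" "smooth_at B (\<phi> m) f"
  shows "smooth_at M m (f \<circ> \<phi>)"
proof -
  obtain V where "\<phi> m \<in> V" "smooth_on B V f"
    using assms(2) unfolding smooth_at_def by blast
  then show ?thesis
    using smooth_on_imp_smooth_at[OF smooth_on_comp_proj, of V f m] assms(1) by (simp add: preimage_def)
qed

text \<open>In a flat chart the points can be slid along their plaques onto the transversal through a given
  point \<open>a'\<close>. This is continuous and preserves the fibres, and it maps points near a point \<open>a\<close> of the
  plaque of \<open>a'\<close> to points near \<open>a'\<close>. Any two points of a fibre are joined by a chain of plaques, so if
  a fibre meets an open set, then all fibres through points close to it meet this set.\<close>

lemma nearby_fibres_meet:
  assumes "(a, b) \<in> leaf_rel M (nci_rank N) (fibre N ` base_space N) (topspace (mtop M))"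
    and "openin (mtop M) W" "b \<in> W"
  shows "\<exists>W'. openin (mtop M) W' \<and> a \<in> W' \<and> \<phi> ` W' \<subseteq> \<phi> ` W"
  using assms(1,3) unfolding leaf_rel_def
proof (induction rule: converse_rtrancl_induct)
  case base
  then show ?case using assms(2) by blast
next
  case (step a a')
  then obtain W1 where W1: "openin (mtop M) W1" "a' \<in> W1" "\<phi> ` W1 \<subseteq> \<phi> ` W"
    by blast
  let ?r = "nci_rank N" and ?n = "mdim M" and ?E = "Euclidean_space (mdim M)"
  obtain U x where flat: "flat_chart M ?r (fibre N ` base_space N) (U, x)"
    and plq: "same_plaque M ?r (U, x) a a'"
    using step(1) by auto
  have U: "openin (mtop M) U"
    and hom: "homeomorphic_map (subtopology (mtop M) U) (subtopology ?E (x ` U)) x"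
    using flat unfolding flat_chart_def smooth_chart_def is_chart_def by auto
  have cube: "x ` U = {z \<in> topspace ?E. \<forall>i<?n. -1 < z i \<and> z i < 1}"
    using flat unfolding flat_chart_def by auto
  have topU: "topspace (subtopology (mtop M) U) = U"
    using openin_subset[OF U] by auto
  have a: "a \<in> U" "a' \<in> U" "\<And>j. j \<in> {?r..<?n} \<Longrightarrow> x a j = x a' j"
    using plq unfolding same_plaque_def by auto
  obtain y where y: "homeomorphic_maps (subtopology (mtop M) U) (subtopology ?E (x ` U)) x y"
    using hom homeomorphic_map_maps by blast
  have yx: "\<And>u. u \<in> U \<Longrightarrow> y (x u) = u"
    using y topU unfolding homeomorphic_maps_def by blast
  \<comment> \<open>The plaque coordinates of the point are replaced by those of the end point of the plaque.\<close>
  define \<psi> where "\<psi> u = (\<lambda>i. if i < ?n then if i < ?r then x a' i else x u i else 0)" for u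
  have in_cube: "(\<forall>i\<ge>?n. x u i = 0) \<and> (\<forall>i<?n. -1 < x u i \<and> x u i < 1)" if "u \<in> U" for u
    using imageI[OF that, of x] unfolding cube by (simp add: topspace_Euclidean_space)
  have coord0: "x u i = 0" if "u \<in> U" "\<not> i < ?n" for u i
    using in_cube that by simp
  have \<psi>_in: "\<psi> u \<in> x ` U" if "u \<in> U" for u
    unfolding cube using that in_cube a(2) by (auto simp: \<psi>_def topspace_Euclidean_space)
  have cx: "continuous_map (subtopology (mtop M) U) ?E x"
    using homeomorphic_imp_continuous_map[OF hom] continuous_map_in_subtopology by blast
  have "continuous_map (subtopology (mtop M) U) euclideanreal (\<lambda>u. if i < ?r then x a' i else x u i)" for i
  proof -
    have "continuous_map ?E euclideanreal (\<lambda>z. z i)"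
      unfolding Euclidean_space_def
      by (intro continuous_map_from_subtopology continuous_map_product_projection) simp
    from continuous_map_compose[OF cx this] show ?thesis
      by (simp add: o_def)
  qed
  then have "continuous_map (subtopology (mtop M) U) ?E \<psi>"
    unfolding \<psi>_def[abs_def] by (simp add: continuous_map_componentwise_Euclidean_space)
  then have "continuous_map (subtopology (mtop M) U) (subtopology ?E (x ` U)) \<psi>"
    using \<psi>_in topU by (auto simp: continuous_map_in_subtopology)
  moreover have "continuous_map (subtopology ?E (x ` U)) (subtopology (mtop M) U) y"
    using y unfolding homeomorphic_maps_def by blast
  ultimately have "continuous_map (subtopology (mtop M) U) (subtopology (mtop M) U) (y \<circ> \<psi>)"
    by (rule continuous_map_compose)
  then have slide: "continuous_map (subtopology (mtop M) U) (mtop M) (y \<circ> \<psi>)"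
    by (simp add: continuous_map_in_subtopology)
  define W' where "W' = {u \<in> U. y (\<psi> u) \<in> W1}"
  have "openin (subtopology (mtop M) U) W'"
    using openin_continuous_map_preimage[OF slide W1(1)] unfolding topU by (simp add: W'_def)
  then have "openin (mtop M) W'"
    using openin_trans_full U by blast
  moreover have "a \<in> W'"
  proof -
    have "\<psi> a = x a'"
      using a coord0 by (auto simp: \<psi>_def fun_eq_iff)
    then show ?thesis
      using a W1 yx by (simp add: W'_def)
  qed
  moreover have "\<phi> ` W' \<subseteq> \<phi> ` W1"
  proof
    fix c assume "c \<in> \<phi> ` W'"
    then obtain u where u: "u \<in> U" "y (\<psi> u) \<in> W1" "c = \<phi> u"
      unfolding W'_def by blast
    obtain w where w: "w \<in> U" "\<psi> u = x w"
      using \<psi>_in u(1) by blast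
    have uM: "u \<in> topspace (mtop M)"
      using u(1) openin_subset[OF U] by blast
    then have "fibre N c \<in> fibre N ` base_space N"
      using u(3) proj_in_base by blast
    then obtain C :: "(nat \<Rightarrow> real) set" where
      C: "fibre N c \<inter> U = {m \<in> U. \<exists>d\<in>C. \<forall>j\<in>{?r..<?n}. x m j = d j}"
      using flat unfolding flat_chart_def by auto
    have same: "x w j = x u j" if "j \<in> {?r..<?n}" for j
      using w(2) that by (auto simp: \<psi>_def fun_eq_iff dest!: spec[of _ j])
    have "u \<in> fibre N c \<inter> U"
      using u uM by (simp add: preimage_def)
    then obtain d where "d \<in> C" "\<forall>j\<in>{?r..<?n}. x u j = d j"
      unfolding C by blast
    then have "w \<in> fibre N c \<inter> U"
      unfolding C using w(1) same by auto
    then have "\<phi> w = c"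
      by (simp add: preimage_def)
    then show "c \<in> \<phi> ` W1"
      using u(2) w yx by auto
  qed
  ultimately show ?case
    using W1(3) by blast
qed

lemma proj_open_map: "open_map (mtop M) (mtop B) \<phi>"
  unfolding open_map_def
proof (intro allI impI)
  fix W assume W: "openin (mtop M) W"
  note WM = openin_subset[OF W]
  have "openin (mtop M) {m \<in> topspace (mtop M). \<phi> m \<in> \<phi> ` W}"
  proof (subst openin_subopen, safe)
    fix a b assume a: "a \<in> topspace (mtop M)" and b: "\<phi> a = \<phi> b" "b \<in> W"
    have "a \<in> fibre N (\<phi> b)" "b \<in> fibre N (\<phi> b)" "fibre N (\<phi> b) \<in> fibre N ` base_space N"
      using a b WM proj_in_base by (auto simp: preimage_def)
    then have "(a, b) \<in> leaf_rel M (nci_rank N) (fibre N ` base_space N) (topspace (mtop M))"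
      using foliation_by_fibres unfolding foliation_def by blast
    from nearby_fibres_meet[OF this W b(2)] obtain W' where
      W': "openin (mtop M) W'" "a \<in> W'" "\<phi> ` W' \<subseteq> \<phi> ` W" by blast
    then show "\<exists>T. openin (mtop M) T \<and> a \<in> T \<and> T \<subseteq> {m \<in> topspace (mtop M). \<phi> m \<in> \<phi> ` W}"
      using openin_subset[OF W'(1)] by blast
  qed
  moreover have "\<phi> ` W \<subseteq> base_space N"
    using WM proj_surj by blast
  ultimately show "openin (mtop B) (\<phi> ` W)"
    using quotient unfolding quotient_map_def by blast
qed

lemma pushforward_in_tangent_space:
  assumes "m \<in> topspace (mtop M)" "v \<in> tangent_space M m"
  shows "pushforward B \<phi> m v \<in> tangent_space B (\<phi> m)"
  using submersion assms unfolding submersion_def by blast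

lemma pull_differential:
  assumes m: "m \<in> topspace (mtop M)" and f: "smooth_at B (\<phi> m) f"
  shows "pull N m (differential B f (\<phi> m)) = differential M (f \<circ> \<phi>) m"
  using pushforward_in_tangent_space[OF m] f
  by (auto simp: pullback_def differential_def pushforward_def fun_eq_iff)

lemma pull_lincomb:
  "pull N m (\<lambda>v. a * \<xi> v + b * \<eta> v) = (\<lambda>v. a * pull N m \<xi> v + b * pull N m \<eta> v)"
  by (auto simp: pullback_def fun_eq_iff)

lemma pull_sum:
  "pull N m (\<lambda>v. \<Sum>i<k. c i * \<xi> i v) = (\<lambda>v. \<Sum>i<k. c i * pull N m (\<xi> i) v)"
  by (auto simp: pullback_def fun_eq_iff)

lemma pull_in_cotangent_space:
  assumes m: "m \<in> topspace (mtop M)" and \<xi>: "\<xi> \<in> cotangent_space B (\<phi> m)"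
  shows "pull N m \<xi> \<in> cotangent_space M m"
proof -
  have "pushforward B \<phi> m (\<lambda>f. v f + w f) = (\<lambda>f. pushforward B \<phi> m v f + pushforward B \<phi> m w f)" for v w
    by (auto simp: pushforward_def fun_eq_iff)
  moreover have "pushforward B \<phi> m (\<lambda>f. c * v f) = (\<lambda>f. c * pushforward B \<phi> m v f)" for c v
    by (auto simp: pushforward_def fun_eq_iff)
  ultimately show ?thesis
    using pushforward_in_tangent_space[OF m] \<xi>
    by (simp add: cotangent_space_def pullback_def tangent_space_add tangent_space_scale)
qed

section \<open>The action bundle\<close>

lemma ker_total_lincomb:
  assumes "\<xi> \<in> ker_total N b" "\<eta> \<in> ker_total N b"
  shows "(\<lambda>v. x * \<xi> v + y * \<eta> v) \<in> ker_total N b"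
proof -
  have cot: "\<xi> \<in> cotangent_space B b" "\<eta> \<in> cotangent_space B b"
    using assms by (auto simp: ker_total_def)
  have "sharp M m (pull N m (\<lambda>v. x * \<xi> v + y * \<eta> v)) = (\<lambda>_. 0)" if "m \<in> fibre N b" for m
  proof -
    have m: "m \<in> topspace (mtop M)" "\<phi> m = b"
      using that by (auto simp: preimage_def)
    have "sharp M m (pull N m \<xi>) = (\<lambda>_. 0)" "sharp M m (pull N m \<eta>) = (\<lambda>_. 0)"
      using assms that by (auto simp: ker_total_def)
    then show ?thesis
      using sharp_lincomb[OF poisson_total m(1), of "pull N m \<xi>" "pull N m \<eta>"]
        pull_in_cotangent_space[OF m(1)] cot m(2)
      by (simp add: pull_lincomb)
  qed
  then show ?thesis
    using cot cotangent_space_lincomb by (simp add: ker_total_def)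
qed

lemma zero_in_ker_total: "(\<lambda>_. 0) \<in> ker_total N b"
proof -
  have "pull N m (\<lambda>_. 0) = (\<lambda>_. 0)" for m
    by (simp add: pullback_def fun_eq_iff)
  then show ?thesis
    using sharp_zero[OF poisson_total] zero_in_cotangent_space
    by (auto simp: ker_total_def preimage_def)
qed

lemma ker_total_sum:
  assumes "\<And>i. i < k \<Longrightarrow> \<xi> i \<in> ker_total N b"
  shows "(\<lambda>v. \<Sum>i<(k::nat). c i * \<xi> i v) \<in> ker_total N b"
  using assms
proof (induction k)
  case 0
  then show ?case by (simp add: zero_in_ker_total)
next
  case (Suc k)
  then show ?case
    using ker_total_lincomb[of "\<lambda>v. \<Sum>i<k. c i * \<xi> i v" b "\<xi> k" 1 "c k"] by simp
qed

lemma act_class_eqI: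
  assumes "(\<lambda>v. \<xi> v - \<eta> v) \<in> ker_total N b"
  shows "act_class N b \<xi> = act_class N b \<eta>"
proof -
  have "(\<lambda>v. \<zeta> v - \<xi> v) \<in> ker_total N b \<longleftrightarrow> (\<lambda>v. \<zeta> v - \<eta> v) \<in> ker_total N b" for \<zeta>
    using ker_total_lincomb[OF _ assms, of "\<lambda>v. \<zeta> v - \<xi> v" 1 1]
      ker_total_lincomb[OF _ assms, of "\<lambda>v. \<zeta> v - \<eta> v" 1 "-1"] by auto
  then show ?thesis
    by (simp add: act_class_def)
qed

lemma self_in_act_class: "\<xi> \<in> ker_base N b \<Longrightarrow> \<xi> \<in> act_class N b \<xi>"
  by (simp add: act_class_def zero_in_ker_total)

lemma act_class_eqD:
  assumes "act_class N b \<xi> = act_class N b \<eta>" "\<xi> \<in> ker_base N b"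
  shows "(\<lambda>v. \<xi> v - \<eta> v) \<in> ker_total N b"
proof -
  have "\<xi> \<in> act_class N b \<eta>"
    using self_in_act_class[OF assms(2)] assms(1) by simp
  then show ?thesis
    by (simp add: act_class_def)
qed

lemma differential_casimir_in_ker_base:
  assumes "casimir B V f" "b \<in> V"
  shows "differential B f b \<in> ker_base N b"
  using assms differential_in_cotangent_space
  by (simp add: ker_base_def casimir_iff_sharp[OF poisson_base])

text \<open>Because \<open>\<phi>\<^sup>*dF = d(F \<circ> \<phi>)\<close>, the condition \<open>dF \<in> Ker (\<Pi>\<^sup>\<sharp> \<circ> \<phi>\<^sup>*)\<close> says that \<open>F \<circ> \<phi>\<close> is a
  Casimir function. This is the source of the exactness of the sequence
  \<open>0 \<rightarrow> Cas\<^sup>M \<rightarrow> Cas \<rightarrow> E\<^sup>0 \<rightarrow> 0\<close> at its middle term, which is stated in \<open>d_class_eq_iff_CasM\<close>.\<close>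

lemma CasM_iff_differential:
  "F \<in> CasM N V \<longleftrightarrow> smooth_on B V F \<and> (\<forall>b\<in>V. differential B F b \<in> ker_total N b)"
proof -
  have "casimir M (preimage N V) (F \<circ> \<phi>) \<longleftrightarrow> (\<forall>b\<in>V. differential B F b \<in> ker_total N b)"
    if F: "smooth_on B V F"
  proof -
    have "pull N m (differential B F b) = differential M (F \<circ> \<phi>) m" if "b \<in> V" "m \<in> fibre N b" for m b
      using pull_differential[of m F] that smooth_on_imp_smooth_at[OF F] by (auto simp: preimage_def)
    then have "(\<forall>b\<in>V. differential B F b \<in> ker_total N b) \<longleftrightarrow>
        (\<forall>b\<in>V. \<forall>m\<in>fibre N b. sharp M m (differential M (F \<circ> \<phi>) m) = (\<lambda>_. 0))"
      by (simp add: ker_total_def differential_in_cotangent_space)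
    then show ?thesis
      unfolding casimir_iff_sharp[OF poisson_total] using smooth_on_comp_proj[OF F]
      by (auto simp: preimage_def)
  qed
  then show ?thesis
    by (auto simp: CasM_def)
qed

text \<open>As \<open>\<phi>\<close> is a surjective Poisson map, \<open>{F, g}\<close> can be computed upstairs, where it is
  \<open>{F \<circ> \<phi>, g \<circ> \<phi>} = 0\<close>.\<close>

lemma CasM_subset_Cas: "CasM N V \<subseteq> Cas N V"
proof
  fix F assume F: "F \<in> CasM N V"
  then have sF: "smooth_on B V F" by (simp add: CasM_def)
  have "sharp B b (differential B F b) = (\<lambda>_. 0)" if b: "b \<in> V" for b
  proof -
    have "bracket B F g b = 0" if g: "smooth_at B b g" for g
    proof -
      obtain V' where V': "b \<in> V'" "smooth_on B V' g"
        using g unfolding smooth_at_def by blast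
      have open_VV': "base_open N (V \<inter> V')"
        using openin_Int smooth_on_openin sF V'(2) by blast
      have "b \<in> base_space N"
        using openin_subset[OF smooth_on_openin[OF sF]] b by (rule subsetD)
      then obtain m where m: "m \<in> topspace (mtop M)" "\<phi> m = b"
        by (rule base_point_lift)
      have "bracket B F g b = bracket M (F \<circ> \<phi>) (g \<circ> \<phi>) m"
        using poisson_map[unfolded poisson_map_def, THEN conjunct2, rule_format, OF conjI,
            OF smooth_on_mono[OF smooth_base sF open_VV' Int_lower1]
              smooth_on_mono[OF smooth_base V'(2) open_VV' Int_lower2] m(1)] m b V'(1) by simp
      also have "\<dots> = sharp M m (pull N m (differential B F b)) (g \<circ> \<phi>)"
        using pull_differential[OF m(1)] smooth_on_imp_smooth_at[OF sF b] m(2)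
          smooth_at_comp_proj[OF m(1)] g by (simp add: sharp_differential)
      also have "\<dots> = 0"
      proof -
        have "differential B F b \<in> ker_total N b" "m \<in> fibre N b"
          using F b m by (auto simp: CasM_iff_differential preimage_def)
        then show ?thesis
          by (simp add: ker_total_def)
      qed
      finally show ?thesis .
    qed
    then show ?thesis
      by (simp add: sharp_differential fun_eq_iff)
  qed
  then show "F \<in> Cas N V"
    using sF by (simp add: Cas_def casimir_iff_sharp[OF poisson_base])
qed

lemma differential_diff:
  assumes "smooth_on B V F" "smooth_on B V G" "b \<in> V"
  shows "differential B (\<lambda>x. F x - G x) b = (\<lambda>v. differential B F b v - differential B G b v)"
  using differential_lincomb[OF smooth_base assms(1,2)[THEN smooth_on_imp_smooth_at, OF assms(3)], of 1 "-1"]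
  by simp

lemma d_class_eq_iff_CasM:
  assumes F: "F \<in> Cas N V" and G: "G \<in> Cas N V"
  shows "(\<forall>b\<in>V. d_class N F b = d_class N G b) \<longleftrightarrow> (\<lambda>x. F x - G x) \<in> CasM N V"
proof -
  have sm: "smooth_on B V F" "smooth_on B V G"
    using F G casimir_smooth_on by (auto simp: Cas_def)
  have "smooth_on B V (\<lambda>x. F x - G x)"
    using smooth_on_lincomb[OF smooth_base sm, of 1 "-1"] by simp
  moreover have "d_class N F b = d_class N G b \<longleftrightarrow> differential B (\<lambda>x. F x - G x) b \<in> ker_total N b"
    if b: "b \<in> V" for b
    unfolding d_class_def differential_diff[OF sm b]
    using act_class_eqI act_class_eqD differential_casimir_in_ker_base[OF _ b] F unfolding Cas_def by blast
  ultimately show ?thesis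
    by (simp add: CasM_iff_differential)
qed

section \<open>Lattice sections in the presence of action variables\<close>

lemma d_class_germ:
  assumes "smooth_on B V F" "b \<in> V" "\<And>c. c \<in> V \<Longrightarrow> F c = G c"
  shows "d_class N F b = d_class N G b"
  unfolding d_class_def using differential_germ[of B V F b G] assms by simp

text \<open>Locally \<open>s = [\<omega>]\<close>, and \<open>s\<close> differs from \<open>[dP]\<close> at \<open>b\<close> exactly if the vector \<open>\<Pi>\<^sup>\<sharp>(\<phi>\<^sup>*(\<omega> - dP))\<close> is
  nonzero at some point \<open>m\<close> over \<open>b\<close>, hence detected there by some function \<open>g\<close>. The pairing
  with \<open>dg\<close> is continuous, so it is nonzero near \<open>m\<close>; since \<open>\<phi>\<close> is open, the points of this neighbourhood
  lie over a neighbourhood of \<open>b\<close>.\<close>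

lemma closedin_equalizer:
  assumes s: "action_section N (base_space N) s" and P: "P \<in> Cas N (base_space N)"
  shows "closedin (mtop B) {b \<in> base_space N. s b = d_class N P b}"
proof -
  have "openin (mtop B) {b \<in> base_space N. s b \<noteq> d_class N P b}"
  proof (rule openin_subopen[THEN iffD2], rule ballI)
    fix b assume "b \<in> {b \<in> base_space N. s b \<noteq> d_class N P b}"
    then have b: "b \<in> base_space N" "s b \<noteq> d_class N P b" by simp_all
    have sP: "smooth_on B (base_space N) P" and casP: "casimir B (base_space N) P"
      using P casimir_smooth_on by (auto simp: Cas_def)
    obtain W \<omega> where W: "base_open N W" "b \<in> W" "one_form B W \<omega>"
      and \<omega>: "\<And>c. c \<in> W \<Longrightarrow> \<omega> c \<in> ker_base N c" "\<And>c. c \<in> W \<Longrightarrow> s c = act_class N c (\<omega> c)"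
      using s[unfolded action_section_def, THEN conjunct2, THEN bspec, OF b(1)] by metis
    obtain U x where U: "(U, x) \<in> matlas B" "b \<in> U"
      using atlas_covers[OF smooth_base b(1)] .
    note U_open = atlas_chart(1)[OF smooth_base U(1)]
    let ?n = "mdim B"
    obtain a where a: "\<And>j. j < ?n \<Longrightarrow> smooth_on B (U \<inter> W) (a j)"
      and \<omega>a: "\<And>c. c \<in> U \<inter> W \<Longrightarrow> \<omega> c = (\<lambda>v. \<Sum>j<?n. a j c * differential B (\<lambda>p. x p j) c v)"
      using W(3) U(1) unfolding one_form_def by blast
    define \<delta> where "\<delta> c = (\<lambda>v. \<omega> c v - differential B P c v)" for c
    have \<omega>_cot: "\<omega> c \<in> cotangent_space B c" if "c \<in> W" for c
      using \<omega>(1)[OF that] by (simp add: ker_base_def)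
    have \<delta>_cot: "\<delta> c \<in> cotangent_space B c" if "c \<in> W" for c
      using cotangent_space_lincomb[OF \<omega>_cot[OF that] differential_in_cotangent_space, of 1 "-1" P]
      by (simp add: \<delta>_def)
    have "\<delta> b \<notin> ker_total N b"
      using b(2) \<omega>(2)[OF W(2)] act_class_eqI unfolding \<delta>_def d_class_def by auto
    then obtain m g where m: "m \<in> fibre N b" and g: "sharp M m (pull N m (\<delta> b)) g \<noteq> 0"
      using \<delta>_cot[OF W(2)] unfolding ker_total_def by (auto simp: fun_eq_iff)
    have mM: "m \<in> topspace (mtop M)" "\<phi> m = b"
      using m by (auto simp: preimage_def)
    have "smooth_at M m g"
      using g by (auto simp: sharp_def split: if_splits)
    then obtain V where V: "m \<in> V" "smooth_on M V g"
      unfolding smooth_at_def by blast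
    define O' where "O' = V \<inter> preimage N (U \<inter> W)"
    have O': "openin (mtop M) O'"
      unfolding O'_def using smooth_on_openin[OF V(2)] openin_preimage openin_Int U_open W(1) by blast
    have mO': "m \<in> O'"
      using V(1) mM U(2) W(2) by (simp add: O'_def preimage_def)
    have O'_mem: "u \<in> topspace (mtop M)" "\<phi> u \<in> U \<inter> W" if "u \<in> O'" for u
      using that by (auto simp: O'_def preimage_def)
    \<comment> \<open>The pairing of the difference with \<open>dg\<close>, expressed by smooth functions and their brackets.\<close>
    define h where "h u = (\<Sum>j<?n. a j (\<phi> u) * bracket M ((\<lambda>p. x p j) \<circ> \<phi>) g u) - bracket M (P \<circ> \<phi>) g u" for u
    have h: "sharp M u (pull N u (\<delta> (\<phi> u))) g = h u" if u: "u \<in> O'" for u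
    proof -
      note uM = O'_mem[OF u]
      have g_u: "smooth_at M u g"
        by (rule smooth_on_imp_smooth_at[OF V(2)]) (use u in \<open>simp add: O'_def\<close>)
      have x_u: "smooth_at B (\<phi> u) (\<lambda>p. x p j)" if "j < ?n" for j
        by (rule smooth_on_imp_smooth_at[OF smooth_on_coordinate[OF smooth_base U(1) that]]) (use uM(2) in simp)
      have P_u: "smooth_at B (\<phi> u) P"
        by (rule smooth_on_imp_smooth_at[OF sP proj_in_base[OF uM(1)]])
      have \<omega>_sharp: "sharp M u (pull N u (\<omega> (\<phi> u)))
          = (\<lambda>q. \<Sum>j<?n. a j (\<phi> u) * sharp M u (pull N u (differential B (\<lambda>p. x p j) (\<phi> u))) q)"
        unfolding \<omega>a[OF uM(2)] pull_sum
        by (rule sharp_sum[OF poisson_total uM(1)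
              pull_in_cotangent_space[OF uM(1) differential_in_cotangent_space], THEN conjunct2])
      have \<omega>_term: "sharp M u (pull N u (\<omega> (\<phi> u))) g
          = (\<Sum>j<?n. a j (\<phi> u) * bracket M ((\<lambda>p. x p j) \<circ> \<phi>) g u)"
        unfolding \<omega>_sharp using pull_differential[OF uM(1) x_u] g_u by (simp add: sharp_differential)
      have P_term: "sharp M u (pull N u (differential B P (\<phi> u))) g = bracket M (P \<circ> \<phi>) g u"
        using pull_differential[OF uM(1) P_u] g_u by (simp add: sharp_differential)
      have "sharp M u (pull N u (\<delta> (\<phi> u))) g
          = sharp M u (pull N u (\<omega> (\<phi> u))) g - sharp M u (pull N u (differential B P (\<phi> u))) g"
        using sharp_lincomb[OF poisson_total uM(1)
            pull_in_cotangent_space[OF uM(1) \<omega>_cot] pull_in_cotangent_space[OF uM(1) differential_in_cotangent_space],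
            of 1 "-1" P] uM(2) pull_lincomb[of u 1 "\<omega> (\<phi> u)" "-1" "differential B P (\<phi> u)"]
        by (simp add: \<delta>_def)
      then show ?thesis
        by (simp add: \<omega>_term P_term h_def)
    qed
    have smooth_O': "smooth_on M O' (f \<circ> \<phi>)" if "smooth_on B Y f" "U \<inter> W \<subseteq> Y" for Y f
      by (rule smooth_on_mono[OF smooth_total smooth_on_comp_proj[OF that(1)] O'])
        (use that(2) in \<open>auto simp: O'_def preimage_def\<close>)
    have cont_bracket: "continuous_map (subtopology (mtop M) O') euclideanreal (bracket M f g)"
      if "smooth_on M O' f" for f
    proof -
      have "smooth_on M O' g"
        by (rule smooth_on_mono[OF smooth_total V(2) O']) (simp add: O'_def)
      then show ?thesis
        using poisson_total that smooth_on_continuous[OF smooth_total] unfolding poisson_manifold_def by blast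
    qed
    have "continuous_map (subtopology (mtop M) O') euclideanreal h"
      unfolding h_def[abs_def]
    proof (intro continuous_map_diff continuous_map_sum continuous_map_real_mult cont_bracket)
      fix j assume j: "j \<in> {..<?n}"
      have "smooth_on M O' (a j \<circ> \<phi>)"
        using smooth_O'[OF a] j by simp
      then show "continuous_map (subtopology (mtop M) O') euclideanreal (\<lambda>u. a j (\<phi> u))"
        using smooth_on_continuous[OF smooth_total, of O' "a j \<circ> \<phi>"] by (simp add: o_def)
      show "smooth_on M O' ((\<lambda>p. x p j) \<circ> \<phi>)"
        using smooth_O'[OF smooth_on_coordinate[OF smooth_base U(1)]] j by simp
    next
      show "smooth_on M O' (P \<circ> \<phi>)"
        by (rule smooth_O'[OF sP]) (use openin_subset[OF U_open] in blast)
    qed simp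
    then have pre: "openin (subtopology (mtop M) O') {u \<in> topspace (subtopology (mtop M) O'). h u \<in> - {0}}"
      by (rule openin_continuous_map_preimage) (simp add: open_Compl)
    have "topspace (subtopology (mtop M) O') = O'"
      using openin_subset[OF O'] by auto
    then have Q: "openin (mtop M) {u \<in> O'. h u \<noteq> 0}"
      using openin_trans_full[OF pre O'] by (simp only: Compl_iff singleton_iff)
    have "s (\<phi> u) \<noteq> d_class N P (\<phi> u)" if u: "u \<in> O'" "h u \<noteq> 0" for u
    proof
      assume eq: "s (\<phi> u) = d_class N P (\<phi> u)"
      have uW: "\<phi> u \<in> W"
        using O'_mem[OF u(1)] by blast
      have "\<delta> (\<phi> u) \<in> ker_total N (\<phi> u)"
        unfolding \<delta>_def by (rule act_class_eqD) (use eq \<omega>[OF uW] in \<open>simp_all add: d_class_def\<close>)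
      moreover have "u \<in> fibre N (\<phi> u)"
        using O'_mem[OF u(1)] by (simp add: preimage_def)
      ultimately have "sharp M u (pull N u (\<delta> (\<phi> u))) = (\<lambda>_. 0)"
        unfolding ker_total_def by blast
      then show False
        using h[OF u(1)] u(2) by simp
    qed
    moreover have "b \<in> \<phi> ` {u \<in> O'. h u \<noteq> 0}"
      using h[OF mO'] g mO' mM(2) by auto
    moreover have "openin (mtop B) (\<phi> ` {u \<in> O'. h u \<noteq> 0})"
      using proj_open_map Q unfolding open_map_def by blast
    ultimately show "\<exists>T. openin (mtop B) T \<and> b \<in> T \<and> T \<subseteq> {b \<in> base_space N. s b \<noteq> d_class N P b}"
      using O'_mem(1) proj_in_base by (intro exI[of _ "\<phi> ` {u \<in> O'. h u \<noteq> 0}"]) auto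
  qed
  moreover have "base_space N - {b \<in> base_space N. s b = d_class N P b} = {b \<in> base_space N. s b \<noteq> d_class N P b}"
    by blast
  ultimately show ?thesis
    by (simp add: closedin_def)
qed

text \<open>Representatives of the classes \<open>[dp i]\<close> differ from the forms \<open>dp i\<close> by elements of the subspace
  \<open>ker_total\<close>, which does not affect the class of a linear combination.\<close>

lemma act_comb_d_class:
  assumes p: "\<And>i. i < k \<Longrightarrow> p i \<in> Cas N (base_space N)" and b: "b \<in> base_space N"
  shows "act_comb N b k c (\<lambda>i. d_class N (p i) b) = d_class N (\<lambda>x. \<Sum>i<k. c i * p i x) b"
proof -
  have cas: "casimir B (base_space N) (p i)" if "i < k" for i
    using p[OF that] by (simp add: Cas_def)
  have d: "differential B (\<lambda>x. \<Sum>i<k. c i * p i x) b = (\<lambda>v. \<Sum>i<k. c i * differential B (p i) b v)"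
    using casimir_sum[OF poisson_base openin_topspace, of k p c] cas b by blast
  have "act_class N b (\<lambda>v. \<Sum>i<k. c i * \<xi> i v) = d_class N (\<lambda>x. \<Sum>i<k. c i * p i x) b"
    if \<xi>: "\<forall>i<k. \<xi> i \<in> d_class N (p i) b" for \<xi>
    unfolding d_class_def d
  proof (rule act_class_eqI)
    have "(\<lambda>v. \<xi> i v - differential B (p i) b v) \<in> ker_total N b" if "i < k" for i
      using \<xi> that by (simp add: d_class_def act_class_def)
    then have "(\<lambda>v. \<Sum>i<k. c i * (\<xi> i v - differential B (p i) b v)) \<in> ker_total N b"
      using ker_total_sum[of k "\<lambda>i v. \<xi> i v - differential B (p i) b v" b c] by blast
    then show "(\<lambda>v. (\<Sum>i<k. c i * \<xi> i v) - (\<Sum>i<k. c i * differential B (p i) b v)) \<in> ker_total N b"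
      by (simp add: sum_subtractf right_diff_distrib)
  qed
  moreover have "\<forall>i<k. differential B (p i) b \<in> d_class N (p i) b"
    using self_in_act_class differential_casimir_in_ker_base[OF cas b] by (simp add: d_class_def)
  ultimately have "{act_class N b (\<lambda>v. \<Sum>i<k. c i * \<xi> i v) | \<xi>. \<forall>i<k. \<xi> i \<in> d_class N (p i) b}
      = {d_class N (\<lambda>x. \<Sum>i<k. c i * p i x) b}"
    by (intro equalityI subsetI) (auto intro!: exI[of _ "\<lambda>i. differential B (p i) b"] simp: eq_commute[of "d_class N (\<lambda>x. \<Sum>i<k. c i * p i x) b"])
  then show ?thesis
    unfolding act_comb_def by simp
qed

text \<open>At each point \<open>b\<close> the section is \<open>\<Sum>i. n i \<cdot> [dp i]\<close> for a unique integer vector \<open>n\<close> depending on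
  \<open>b\<close>. The sets where \<open>n\<close> has a given value are closed, disjoint, countable in number, and cover the base, so
  \<open>n\<close> is locally constant. Then \<open>\<Sum>i. n i \<cdot> p i\<close> is a global Casimir function, because locally
  it is a combination of the \<open>p i\<close> with constant coefficients, and its class is the given section.\<close>

lemma lattice_section_lifts:
  assumes p: "global_action_variables N p" and s: "lattice_section N (base_space N) s"
  shows "\<exists>P\<in>Cas N (base_space N). \<forall>b\<in>base_space N. s b = d_class N P b"
proof -
  let ?r = "nci_rank N"
  let ?I = "{..<?r} \<rightarrow>\<^sub>E (UNIV :: int set)"
  define P where "P \<nu> = (\<lambda>x. \<Sum>i<?r. of_int (\<nu> i) * p i x)" for \<nu> :: "nat \<Rightarrow> int"
  define A where "A \<nu> = {b \<in> base_space N. s b = d_class N (P \<nu>) b}" for \<nu>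
  have pc: "casimir B (base_space N) (p i)" if "i < ?r" for i
    using p that by (simp add: global_action_variables_def)
  have P_cas: "casimir B (base_space N) (P \<nu>)" for \<nu>
    unfolding P_def
    using casimir_sum[OF poisson_base openin_topspace, of ?r p "\<lambda>i. of_int (\<nu> i)"] pc by blast
  have basis: "bij_betw (\<lambda>\<nu>. d_class N (P \<nu>) b) ?I (lattice_fibre N b)" if b: "b \<in> base_space N" for b
  proof -
    have "lattice_basis N b ?r (\<lambda>i. d_class N (p i) b)"
      using p b unfolding global_action_variables_def lattice_trivialization_def by blast
    moreover have "act_comb N b ?r (\<lambda>i. of_int (\<nu> i)) (\<lambda>i. d_class N (p i) b) = d_class N (P \<nu>) b"
      for \<nu> :: "nat \<Rightarrow> int"
      unfolding P_def by (rule act_comb_d_class) (use pc b in \<open>auto simp: Cas_def\<close>)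
    ultimately show ?thesis
      unfolding lattice_basis_def by simp
  qed
  have loc: "\<exists>Q \<nu>. base_open N Q \<and> b \<in> Q \<and> \<nu> \<in> ?I \<and> Q \<subseteq> A \<nu>" if b: "b \<in> base_space N" for b
  proof (rule countable_closed_partition_locally_constant[OF locally_connected_manifold[OF smooth_base]
        locally_compact_manifold[OF smooth_base] _ _ _ _ _ b])
    show "Hausdorff_space (mtop B)"
      using smooth_base by (simp add: smooth_manifold_def)
    show "countable ?I"
      by (intro countable_PiE) auto
    show "closedin (mtop B) (A \<nu>)" if "\<nu> \<in> ?I" for \<nu>
      unfolding A_def by (rule closedin_equalizer) (use s P_cas in \<open>auto simp: lattice_section_def Cas_def\<close>)
    show "\<nu> = \<mu>" if "\<nu> \<in> ?I" "\<mu> \<in> ?I" "c \<in> A \<nu>" "c \<in> A \<mu>" for \<nu> \<mu> c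
    proof -
      have c: "c \<in> base_space N" "d_class N (P \<nu>) c = d_class N (P \<mu>) c"
        using that(3,4) by (auto simp: A_def)
      show ?thesis
        using inj_onD[OF bij_betw_imp_inj_on[OF basis[OF c(1)]] c(2) that(1,2)] .
    qed
    show "\<exists>\<nu>\<in>?I. c \<in> A \<nu>" if c: "c \<in> base_space N" for c
    proof -
      have "s c \<in> lattice_fibre N c"
        using s c by (simp add: lattice_section_def)
      then obtain \<nu> where "\<nu> \<in> ?I" "s c = d_class N (P \<nu>) c"
        using bij_betw_imp_surj_on[OF basis[OF c]] by (metis (no_types, lifting) imageE)
      then show ?thesis
        using c by (auto simp: A_def)
    qed
  qed
  define n where "n b = (SOME \<nu>. \<nu> \<in> ?I \<and> b \<in> A \<nu>)" for b
  have n_eq: "n b = \<nu>" if "\<nu> \<in> ?I" "b \<in> A \<nu>" for b \<nu>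
  proof -
    have "n b \<in> ?I" "b \<in> A (n b)"
      using someI[of "\<lambda>\<nu>. \<nu> \<in> ?I \<and> b \<in> A \<nu>" \<nu>] that by (simp_all add: n_def)
    then have c: "b \<in> base_space N" "d_class N (P (n b)) b = d_class N (P \<nu>) b"
      using that by (auto simp: A_def)
    show ?thesis
      using inj_onD[OF bij_betw_imp_inj_on[OF basis[OF c(1)]] c(2) \<open>n b \<in> ?I\<close> that(1)] .
  qed
  define F where "F b = P (n b) b" for b
  have F_loc: "\<exists>Q \<nu>. base_open N Q \<and> b \<in> Q \<and> Q \<subseteq> A \<nu> \<and> (\<forall>c\<in>Q. P \<nu> c = F c)" if b: "b \<in> base_space N" for b
  proof -
    obtain Q \<nu> where Q: "base_open N Q" "b \<in> Q" "\<nu> \<in> ?I" "Q \<subseteq> A \<nu>"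
      using loc[OF b] by blast
    then have "\<forall>c\<in>Q. P \<nu> c = F c"
      using n_eq[OF Q(3)] by (auto simp: F_def)
    with Q show ?thesis by blast
  qed
  have "casimir B (base_space N) F"
  proof (rule casimir_glue[OF poisson_base openin_topspace])
    fix b assume "b \<in> base_space N"
    then obtain Q \<nu> where Q: "base_open N Q" "b \<in> Q" "\<forall>c\<in>Q. P \<nu> c = F c"
      using F_loc by meson
    then show "\<exists>V' f'. b \<in> V' \<and> casimir B V' f' \<and> (\<forall>q\<in>base_space N \<inter> V'. F q = f' q)"
      using casimir_mono[OF poisson_base P_cas Q(1) openin_subset[OF Q(1)], of \<nu>]
      by (intro exI[of _ Q] exI[of _ "P \<nu>"]) auto
  qed
  moreover have "s b = d_class N F b" if b: "b \<in> base_space N" for b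
  proof -
    obtain Q \<nu> where Q: "base_open N Q" "b \<in> Q" "Q \<subseteq> A \<nu>" "\<forall>c\<in>Q. P \<nu> c = F c"
      using F_loc[OF b] by blast
    have "smooth_on B Q (P \<nu>)"
      using casimir_smooth_on[OF casimir_mono[OF poisson_base P_cas Q(1) openin_subset[OF Q(1)]]] .
    then have "d_class N (P \<nu>) b = d_class N F b"
      using d_class_germ Q(2,4) by blast
    then show ?thesis
      using Q(2,3) by (auto simp: A_def)
  qed
  ultimately show ?thesis
    by (auto simp: Cas_def)
qed

end

section \<open>The zero class in first Cech cohomology\<close>

lemma cohomologousE:
  assumes "((\<U>, c), (\<V>, d)) \<in> cohomologous X S"
  obtains \<W> \<rho> \<sigma> h where "open_cover X \<W>"
    and "\<And>W. W \<in> \<W> \<Longrightarrow> \<rho> W \<in> \<U> \<and> W \<subseteq> \<rho> W \<and> \<sigma> W \<in> \<V> \<and> W \<subseteq> \<sigma> W \<and> h W \<in> S W"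
    and "\<And>W W' x. W \<in> \<W> \<Longrightarrow> W' \<in> \<W> \<Longrightarrow> x \<in> W \<inter> W' \<Longrightarrow>
      c (\<rho> W) (\<rho> W') x - d (\<sigma> W) (\<sigma> W') x = h W' x - h W x"
proof -
  obtain \<W> \<rho> \<sigma> h where *: "open_cover X \<W>"
    "\<forall>W\<in>\<W>. \<rho> W \<in> \<U> \<and> W \<subseteq> \<rho> W \<and> \<sigma> W \<in> \<V> \<and> W \<subseteq> \<sigma> W \<and> h W \<in> S W"
    "\<forall>W\<in>\<W>. \<forall>W'\<in>\<W>. \<forall>x\<in>W \<inter> W'. c (\<rho> W) (\<rho> W') x - d (\<sigma> W) (\<sigma> W') x = h W' x - h W x"
    using assms unfolding cohomologous_def by clarify
  show thesis
    by (rule that[of \<W> \<rho> \<sigma> h]) (use * in blast)+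
qed

lemma cohomologousI:
  assumes "(\<U>, c) \<in> cocycles1 X S" "(\<V>, d) \<in> cocycles1 X S" "open_cover X \<W>"
    and "\<And>W. W \<in> \<W> \<Longrightarrow> \<rho> W \<in> \<U> \<and> W \<subseteq> \<rho> W \<and> \<sigma> W \<in> \<V> \<and> W \<subseteq> \<sigma> W \<and> h W \<in> S W"
    and "\<And>W W' x. W \<in> \<W> \<Longrightarrow> W' \<in> \<W> \<Longrightarrow> x \<in> W \<inter> W' \<Longrightarrow>
      c (\<rho> W) (\<rho> W') x - d (\<sigma> W) (\<sigma> W') x = h W' x - h W x"
  shows "((\<U>, c), (\<V>, d)) \<in> cohomologous X S"
proof -
  have "\<exists>\<W> \<rho> \<sigma> h. open_cover X \<W> \<and>
      (\<forall>W\<in>\<W>. \<rho> W \<in> \<U> \<and> W \<subseteq> \<rho> W \<and> \<sigma> W \<in> \<V> \<and> W \<subseteq> \<sigma> W \<and> h W \<in> S W) \<and>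
      (\<forall>W\<in>\<W>. \<forall>W'\<in>\<W>. \<forall>x\<in>W \<inter> W'. c (\<rho> W) (\<rho> W') x - d (\<sigma> W) (\<sigma> W') x = h W' x - h W x)"
    using assms(3-5)
    by - (rule exI[of _ \<W>], rule exI[of _ \<rho>], rule exI[of _ \<sigma>], rule exI[of _ h], blast)
  then show ?thesis
    using assms(1,2) by (simp add: cohomologous_def)
qed

lemma cohomologous_cocycles:
  "((\<U>, c), (\<V>, d)) \<in> cohomologous X S \<Longrightarrow> (\<U>, c) \<in> cocycles1 X S \<and> (\<V>, d) \<in> cocycles1 X S"
  by (simp add: cohomologous_def)

text \<open>A presheaf of additive groups of real functions; sums are obtained as \<open>f - (0 - g)\<close>.\<close>

locale function_presheaf =
  fixes X :: "'b topology" and S :: "'b fun_sheaf"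
  assumes zero: "openin X U \<Longrightarrow> (\<lambda>_. 0) \<in> S U"
    and restrict: "f \<in> S U \<Longrightarrow> openin X V \<Longrightarrow> V \<subseteq> U \<Longrightarrow> f \<in> S V"
    and diff: "f \<in> S U \<Longrightarrow> g \<in> S U \<Longrightarrow> (\<lambda>x. f x - g x) \<in> S U"
begin

lemma zero_cocycle: "({topspace X}, \<lambda>_ _ _. 0) \<in> cocycles1 X S"
  using zero by (simp add: cocycles1_def open_cover_def)

lemma zero_in_H1_zero: "({topspace X}, \<lambda>_ _ _. 0) \<in> H1_zero X S"
  unfolding H1_zero_def
proof (rule ImageI)
  show "(({topspace X}, \<lambda>_ _ _. 0), ({topspace X}, \<lambda>_ _ _. 0)) \<in> cohomologous X S"
    by (rule cohomologousI[where \<W> = "{topspace X}" and \<rho> = "\<lambda>W. W" and \<sigma> = "\<lambda>W. W"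
          and h = "\<lambda>_ _. 0", OF zero_cocycle zero_cocycle])
      (use zero in \<open>auto simp: open_cover_def\<close>)
qed simp

text \<open>A coboundary on \<open>\<U>\<close> is absorbed into the comparison cochain: if \<open>h\<close> on the refinement \<open>\<W>\<close> compares
  \<open>d\<close> with \<open>c\<close>, then \<open>h - k\<close> compares it with \<open>0\<close>. Conversely a comparison of \<open>d\<close> with \<open>0\<close> takes place
  on a cover that need not refine \<open>\<U>\<close>; it is intersected with \<open>\<U>\<close> first.\<close>

lemma coboundary_class:
  assumes cov: "open_cover X \<U>" and k: "\<And>U. U \<in> \<U> \<Longrightarrow> k U \<in> S U"
    and c: "\<And>U V. U \<in> \<U> \<Longrightarrow> V \<in> \<U> \<Longrightarrow> c U V \<in> S (U \<inter> V)"
    and eq: "\<And>U V x. U \<in> \<U> \<Longrightarrow> V \<in> \<U> \<Longrightarrow> x \<in> U \<inter> V \<Longrightarrow> c U V x = k V x - k U x"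
  shows "cohomologous X S `` {(\<U>, c)} = H1_zero X S"
proof -
  have cocycle: "(\<U>, c) \<in> cocycles1 X S"
    unfolding cocycles1_def using cov c eq by simp
  have "((\<U>, c), (\<V>, d)) \<in> cohomologous X S \<longleftrightarrow> (({topspace X}, \<lambda>_ _ _. 0), (\<V>, d)) \<in> cohomologous X S"
    (is "?L \<longleftrightarrow> ?R") for \<V> d
  proof
    assume L: ?L
    from L obtain \<W> \<rho> \<sigma> h where W: "open_cover X \<W>"
      and m: "\<And>W. W \<in> \<W> \<Longrightarrow> \<rho> W \<in> \<U> \<and> W \<subseteq> \<rho> W \<and> \<sigma> W \<in> \<V> \<and> W \<subseteq> \<sigma> W \<and> h W \<in> S W"
      and h: "\<And>W W' x. W \<in> \<W> \<Longrightarrow> W' \<in> \<W> \<Longrightarrow> x \<in> W \<inter> W' \<Longrightarrow>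
        c (\<rho> W) (\<rho> W') x - d (\<sigma> W) (\<sigma> W') x = h W' x - h W x"
      by (rule cohomologousE) blast
    have W_open: "openin X W" if "W \<in> \<W>" for W
      using W that by (simp add: open_cover_def)
    define h' where "h' W = (\<lambda>x. h W x - k (\<rho> W) x)" for W
    have "h' W \<in> S W" if "W \<in> \<W>" for W
      unfolding h'_def using diff restrict[OF k W_open[OF that]] m[OF that] by blast
    moreover have "0 - d (\<sigma> W) (\<sigma> W') x = h' W' x - h' W x" if "W \<in> \<W>" "W' \<in> \<W>" "x \<in> W \<inter> W'" for W W' x
    proof -
      have "x \<in> \<rho> W \<inter> \<rho> W'"
        using m[OF that(1)] m[OF that(2)] that(3) by blast
      then show ?thesis
        using h[OF that] eq[of "\<rho> W" "\<rho> W'" x] m[OF that(1)] m[OF that(2)] by (simp add: h'_def)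
    qed
    moreover have "W \<subseteq> topspace X" if "W \<in> \<W>" for W
      using openin_subset W_open[OF that] .
    ultimately show ?R
      using cohomologous_cocycles[OF L] m
      by (intro cohomologousI[where \<rho> = "\<lambda>_. topspace X" and \<sigma> = \<sigma> and h = h', OF zero_cocycle _ W]) blast+
  next
    assume R: ?R
    from R obtain \<W> \<rho> \<sigma> h where W: "open_cover X \<W>"
      and m: "\<And>W. W \<in> \<W> \<Longrightarrow> \<rho> W \<in> {topspace X} \<and> W \<subseteq> \<rho> W \<and> \<sigma> W \<in> \<V> \<and> W \<subseteq> \<sigma> W \<and> h W \<in> S W"
      and h: "\<And>W W' x. W \<in> \<W> \<Longrightarrow> W' \<in> \<W> \<Longrightarrow> x \<in> W \<inter> W' \<Longrightarrow>
        0 - d (\<sigma> W) (\<sigma> W') x = h W' x - h W x"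
      by (rule cohomologousE) blast
    define \<Y> where "\<Y> = {W \<inter> U | W U. W \<in> \<W> \<and> U \<in> \<U>}"
    have Y_cov: "open_cover X \<Y>"
      unfolding open_cover_def
    proof
      show "\<forall>Y\<in>\<Y>. openin X Y"
        using W cov unfolding open_cover_def \<Y>_def by auto
      have "\<Union> \<Y> = \<Union> \<W> \<inter> \<Union> \<U>"
        unfolding \<Y>_def by blast
      then show "\<Union> \<Y> = topspace X"
        using W cov unfolding open_cover_def by simp
    qed
    have "\<forall>Y\<in>\<Y>. \<exists>W U. W \<in> \<W> \<and> U \<in> \<U> \<and> Y \<subseteq> W \<and> Y \<subseteq> U"
      unfolding \<Y>_def by blast
    then obtain \<tau> \<alpha> where t: "\<And>Y. Y \<in> \<Y> \<Longrightarrow> \<tau> Y \<in> \<W> \<and> \<alpha> Y \<in> \<U> \<and> Y \<subseteq> \<tau> Y \<and> Y \<subseteq> \<alpha> Y"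
      by metis
    have Y_open: "openin X Y" if "Y \<in> \<Y>" for Y
      using Y_cov that by (simp add: open_cover_def)
    \<comment> \<open>This is the sum of \<open>h\<close> and \<open>k\<close>, written with subtractions.\<close>
    define h' where "h' Y = (\<lambda>x. h (\<tau> Y) x - (0 - k (\<alpha> Y) x))" for Y
    have "h' Y \<in> S Y" if Y: "Y \<in> \<Y>" for Y
    proof -
      have "h (\<tau> Y) \<in> S Y" "k (\<alpha> Y) \<in> S Y"
        using restrict[OF _ Y_open[OF Y]] m k t[OF Y] by blast+
      then show ?thesis
        unfolding h'_def using diff[OF _ diff[OF zero[OF Y_open[OF Y]]]] by blast
    qed
    moreover have "c (\<alpha> Y) (\<alpha> Y') x - d (\<sigma> (\<tau> Y)) (\<sigma> (\<tau> Y')) x = h' Y' x - h' Y x"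
      if "Y \<in> \<Y>" "Y' \<in> \<Y>" "x \<in> Y \<inter> Y'" for Y Y' x
    proof -
      have "x \<in> \<alpha> Y \<inter> \<alpha> Y'" "x \<in> \<tau> Y \<inter> \<tau> Y'"
        using t[OF that(1)] t[OF that(2)] that(3) by blast+
      then show ?thesis
        using h[of "\<tau> Y" "\<tau> Y'" x] eq[of "\<alpha> Y" "\<alpha> Y'" x] t[OF that(1)] t[OF that(2)] by (simp add: h'_def)
    qed
    moreover have "\<sigma> (\<tau> Y) \<in> \<V> \<and> Y \<subseteq> \<sigma> (\<tau> Y)" if "Y \<in> \<Y>" for Y
      using t[OF that] m by (meson subset_trans)
    ultimately show ?L
      using cohomologous_cocycles[OF R] t
      by (intro cohomologousI[where \<rho> = \<alpha> and \<sigma> = "\<lambda>Y. \<sigma> (\<tau> Y)" and h = h', OF cocycle _ Y_cov]) blast+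
  qed
  then show ?thesis
    unfolding H1_zero_def by (auto simp del: split_paired_All)
qed

end

section \<open>The obstruction map\<close>

context nci_fibration
begin

lemma CasM_presheaf: "function_presheaf (mtop B) (CasM N)"
proof
  show "(\<lambda>_. 0) \<in> CasM N U" if "base_open N U" for U
    using smooth_on_const[OF that] differential_zero[of _ B] openin_subset[OF that] zero_in_ker_total
    by (auto simp: CasM_iff_differential)
  show "f \<in> CasM N V" if "f \<in> CasM N U" "base_open N V" "V \<subseteq> U" for f U V
    using that smooth_on_mono[OF smooth_base] by (auto simp: CasM_iff_differential)
  show "(\<lambda>x. f x - g x) \<in> CasM N U" if "f \<in> CasM N U" "g \<in> CasM N U" for f g U
  proof -
    have sm: "smooth_on B U f" "smooth_on B U g"
      using that by (auto simp: CasM_iff_differential)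
    have "smooth_on B U (\<lambda>x. f x - g x)"
      using smooth_on_lincomb[OF smooth_base sm, of 1 "-1"] by simp
    moreover have "differential B (\<lambda>x. f x - g x) b \<in> ker_total N b" if "b \<in> U" for b
      unfolding differential_diff[OF sm that]
      using ker_total_lincomb[of "differential B f b" b "differential B g b" 1 "-1"]
        \<open>f \<in> CasM N U\<close> \<open>g \<in> CasM N U\<close> that by (simp add: CasM_iff_differential)
    ultimately show ?thesis
      by (simp add: CasM_iff_differential)
  qed
qed

interpretation CasM: function_presheaf "mtop B" "CasM N"
  by (rule CasM_presheaf)

lemma Cas_mono: "F \<in> Cas N U \<Longrightarrow> base_open N V \<Longrightarrow> V \<subseteq> U \<Longrightarrow> F \<in> Cas N V"
  using casimir_mono[OF poisson_base] by (auto simp: Cas_def)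

text \<open>Local lifts \<open>g U\<close> differ from a global lift \<open>P\<close> by sections of \<open>Cas\<^sup>M\<close>, and the cocycle
  \<open>g V - g U\<close> is the coboundary of these differences.\<close>

lemma Obs_of_globally_holonomic_section:
  assumes P: "P \<in> Cas N (base_space N)" and s: "\<And>b. b \<in> base_space N \<Longrightarrow> s b = d_class N P b"
  shows "Obs N s = H1_zero (mtop B) (CasM N)"
proof -
  have zero: "cohomologous (mtop B) (CasM N) `` {(\<U>, \<lambda>U V x. g V x - g U x)} = H1_zero (mtop B) (CasM N)"
    if lifts: "local_lifts N s \<U> g" for \<U> g
  proof (rule CasM.coboundary_class)
    show cov: "open_cover (mtop B) \<U>"
      using lifts by (simp add: local_lifts_def)
    have U_open: "base_open N U" if "U \<in> \<U>" for U
      using cov that by (simp add: open_cover_def)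
    have g: "g U \<in> Cas N U" "\<And>b. b \<in> U \<Longrightarrow> s b = d_class N (g U) b" if "U \<in> \<U>" for U
      using lifts that by (auto simp: local_lifts_def)
    show k: "(\<lambda>x. g U x - P x) \<in> CasM N U" if U: "U \<in> \<U>" for U
    proof (rule d_class_eq_iff_CasM[THEN iffD1])
      show "g U \<in> Cas N U" "P \<in> Cas N U"
        using g(1)[OF U] Cas_mono[OF P U_open[OF U] openin_subset[OF U_open[OF U]]] by auto
      show "\<forall>b\<in>U. d_class N (g U) b = d_class N P b"
        using g(2)[OF U] s openin_subset[OF U_open[OF U]] by (metis subsetD)
    qed
    show "(\<lambda>x. g V x - g U x) \<in> CasM N (U \<inter> V)" if "U \<in> \<U>" "V \<in> \<U>" for U V
    proof -
      have UV: "base_open N (U \<inter> V)"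
        using U_open that by blast
      show ?thesis
        using CasM.diff[OF CasM.restrict[OF k[OF that(2)] UV Int_lower2] CasM.restrict[OF k[OF that(1)] UV Int_lower1]]
        by simp
    qed
  qed simp
  have "local_lifts N s {base_space N} (\<lambda>_. P)"
    using P s by (simp add: local_lifts_def open_cover_def)
  with zero show ?thesis
    unfolding Obs_def by (intro equalityI subsetI) blast+
qed

text \<open>If the cocycle of the local lifts \<open>g\<close> becomes a coboundary of \<open>h\<close> on a refinement, then the functions
  \<open>g - h\<close> agree on overlaps; they are still Casimir functions of \<open>\<pi>\<close> and still lift the section,
  as the \<open>h\<close> are sections of \<open>Cas\<^sup>M\<close>. The zero class contains the zero cocycle, so its being the value of
  the obstruction map includes the existence of local lifts.\<close>

lemma globally_holonomic_if_Obs_zero: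
  assumes "Obs N s = H1_zero (mtop B) (CasM N)"
  shows "\<exists>P\<in>Cas N (base_space N). \<forall>b\<in>base_space N. s b = d_class N P b"
proof -
  have "({base_space N}, \<lambda>_ _ _. 0) \<in> Obs N s"
    using CasM.zero_in_H1_zero assms by simp
  then obtain \<U> g where lifts: "local_lifts N s \<U> g"
    and coh: "((\<U>, \<lambda>U V x. g V x - g U x), ({base_space N}, \<lambda>_ _ _. 0)) \<in> cohomologous (mtop B) (CasM N)"
    unfolding Obs_def by blast
  from coh obtain \<W> \<rho> \<sigma> h where W: "open_cover (mtop B) \<W>"
    and m: "\<And>W. W \<in> \<W> \<Longrightarrow>
        \<rho> W \<in> \<U> \<and> W \<subseteq> \<rho> W \<and> \<sigma> W \<in> {base_space N} \<and> W \<subseteq> \<sigma> W \<and> h W \<in> CasM N W"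
    and h: "\<And>W W' x. W \<in> \<W> \<Longrightarrow> W' \<in> \<W> \<Longrightarrow> x \<in> W \<inter> W' \<Longrightarrow>
        g (\<rho> W') x - g (\<rho> W) x - 0 = h W' x - h W x"
    by (rule cohomologousE) blast
  have W_open: "base_open N W" if "W \<in> \<W>" for W
    using W that by (simp add: open_cover_def)
  have g: "g (\<rho> W) \<in> Cas N W" "\<And>b. b \<in> W \<Longrightarrow> s b = d_class N (g (\<rho> W)) b" if "W \<in> \<W>" for W
    using lifts m[OF that] Cas_mono[OF _ W_open[OF that]] by (auto simp: local_lifts_def)
  define f where "f W = (\<lambda>x. g (\<rho> W) x - h W x)" for W
  have f_cas: "f W \<in> Cas N W" if "W \<in> \<W>" for W
  proof -
    have "h W \<in> Cas N W"
      using m[OF that] CasM_subset_Cas by blast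
    then show ?thesis
      using casimir_lincomb[OF poisson_base, of W "g (\<rho> W)" "h W" 1 "-1"] g(1)[OF that]
      by (simp add: Cas_def f_def)
  qed
  have f_class: "s b = d_class N (f W) b" if "W \<in> \<W>" "b \<in> W" for W b
    using d_class_eq_iff_CasM[OF g(1)[OF that(1)] f_cas[OF that(1)]] m[OF that(1)] g(2)[OF that] that(2)
    by (simp add: f_def)
  have f_glue: "f W x = f W' x" if "W \<in> \<W>" "W' \<in> \<W>" "x \<in> W \<inter> W'" for W W' x
    using h[OF that] by (simp add: f_def)
  define P where "P b = f (SOME W. W \<in> \<W> \<and> b \<in> W) b" for b
  have P_eq: "P b = f W b" if "W \<in> \<W>" "b \<in> W" for W b
    unfolding P_def using someI[of "\<lambda>W. W \<in> \<W> \<and> b \<in> W" W] that by (intro f_glue) auto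
  have cover: "\<exists>W\<in>\<W>. b \<in> W" if "b \<in> base_space N" for b
    using W that unfolding open_cover_def by blast
  have "casimir B (base_space N) P"
  proof (rule casimir_glue[OF poisson_base openin_topspace])
    fix b assume "b \<in> base_space N"
    then obtain W where "W \<in> \<W>" "b \<in> W"
      using cover by blast
    then show "\<exists>V' f'. b \<in> V' \<and> casimir B V' f' \<and> (\<forall>q\<in>base_space N \<inter> V'. P q = f' q)"
      using f_cas P_eq by (intro exI[of _ W] exI[of _ "f W"]) (simp add: Cas_def)
  qed
  moreover have "s b = d_class N P b" if b: "b \<in> base_space N" for b
  proof -
    obtain W where Wb: "W \<in> \<W>" "b \<in> W"
      using cover b by blast
    have "smooth_on B W (f W)"
      using f_cas[OF Wb(1)] casimir_smooth_on by (simp add: Cas_def)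
    then have "d_class N (f W) b = d_class N P b"
      using P_eq[OF Wb(1)] by (intro d_class_germ[OF _ Wb(2)]) simp_all
    then show ?thesis
      using f_class[OF Wb] by simp
  qed
  ultimately show ?thesis
    by (auto simp: Cas_def)
qed

lemma lattice_trivialization_cong:
  assumes l: "lattice_trivialization N (base_space N) l"
    and eq: "\<And>i b. i < nci_rank N \<Longrightarrow> b \<in> base_space N \<Longrightarrow> l i b = l' i b"
  shows "lattice_trivialization N (base_space N) l'"
  unfolding lattice_trivialization_def
proof (intro conjI allI impI ballI)
  fix i assume i: "i < nci_rank N"
  then have li: "action_section N (base_space N) (l i)" "\<And>b. b \<in> base_space N \<Longrightarrow> l i b \<in> lattice_fibre N b"
    using l by (simp_all add: lattice_trivialization_def lattice_section_def)
  have "action_section N (base_space N) (l' i)"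
    unfolding action_section_def
  proof (intro conjI ballI)
    fix b assume b: "b \<in> base_space N"
    obtain W \<omega> where W: "base_open N W" "b \<in> W" "W \<subseteq> base_space N" "one_form B W \<omega>"
      and \<omega>: "\<forall>c\<in>W. \<omega> c \<in> ker_base N c \<and> l i c = act_class N c (\<omega> c)"
      using li(1)[unfolded action_section_def, THEN conjunct2, THEN bspec, OF b] by metis
    have "\<forall>c\<in>W. \<omega> c \<in> ker_base N c \<and> l' i c = act_class N c (\<omega> c)"
      using \<omega> eq[OF i] W(3) by (metis subsetD)
    then show "\<exists>W \<omega>. base_open N W \<and> b \<in> W \<and> W \<subseteq> base_space N \<and> one_form B W \<omega> \<and>
        (\<forall>c\<in>W. \<omega> c \<in> ker_base N c \<and> l' i c = act_class N c (\<omega> c))"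
      using W by (intro exI[of _ W] exI[of _ \<omega>] conjI)
  qed simp
  then show "lattice_section N (base_space N) (l' i)"
    using li(2) eq[OF i] by (simp add: lattice_section_def)
next
  fix b assume b: "b \<in> base_space N"
  have "act_comb N b (nci_rank N) c (\<lambda>i. l i b) = act_comb N b (nci_rank N) c (\<lambda>i. l' i b)" for c
    using eq[OF _ b] unfolding act_comb_def by simp
  moreover have "lattice_basis N b (nci_rank N) (\<lambda>i. l i b)"
    using l b by (simp add: lattice_trivialization_def)
  ultimately show "lattice_basis N b (nci_rank N) (\<lambda>i. l' i b)"
    by (simp add: lattice_basis_def)
qed

end

theorem theorem3p6:
  fixes N :: "('a, 'b) nci"
  assumes "nci_system N" and "compact_fibres N"
  shows "(\<exists>p. global_action_variables N p) \<longleftrightarrow>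
    (\<exists>l. lattice_trivialization N (base_space N) l) \<and>
    (\<forall>l. lattice_section N (base_space N) l \<longrightarrow>
       Obs N l = H1_zero (mtop (base N)) (CasM N))"
proof -
  interpret nci_fibration N
    by (unfold_locales) (rule assms(1))
  show ?thesis
  proof (intro iffI conjI allI impI)
    assume "\<exists>p. global_action_variables N p"
    then obtain p where p: "global_action_variables N p" ..
    then show "\<exists>l. lattice_trivialization N (base_space N) l"
      unfolding global_action_variables_def by blast
    fix l assume "lattice_section N (base_space N) l"
    then obtain P where "P \<in> Cas N (base_space N)" "\<forall>b\<in>base_space N. l b = d_class N P b"
      using lattice_section_lifts[OF p] by blast
    then show "Obs N l = H1_zero (mtop (base N)) (CasM N)"
      by (intro Obs_of_globally_holonomic_section) auto
  next
    assume R: "(\<exists>l. lattice_trivialization N (base_space N) l) \<and>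
      (\<forall>l. lattice_section N (base_space N) l \<longrightarrow> Obs N l = H1_zero (mtop (base N)) (CasM N))"
    then obtain l where l: "lattice_trivialization N (base_space N) l" by blast
    have "\<exists>P\<in>Cas N (base_space N). \<forall>b\<in>base_space N. l i b = d_class N P b" if "i < nci_rank N" for i
      using R l that by (intro globally_holonomic_if_Obs_zero) (auto simp: lattice_trivialization_def)
    then obtain p where p: "\<And>i. i < nci_rank N \<Longrightarrow> p i \<in> Cas N (base_space N)"
      "\<And>i b. i < nci_rank N \<Longrightarrow> b \<in> base_space N \<Longrightarrow> l i b = d_class N (p i) b"
      by metis
    have "lattice_trivialization N (base_space N) (\<lambda>i. d_class N (p i))"
      by (rule lattice_trivialization_cong[OF l]) (rule p(2))
    then show "\<exists>p. global_action_variables N p"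
      using p(1) unfolding global_action_variables_def Cas_def by blast
  qed
qed

end
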